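(* Let $G$ be a totally disconnected locally compact group, let $\mathcal{H}\le\mathrm{Aut}(G)$ be flat, let $U$ be a compact open subgroup of $G$ tidy for $\mathcal{H}$ and let $\rho\in\Phi(\mathcal{H})$. Suppose $\alpha_1,\dots,\alpha_k\in\mathcal{H}$ are such that for every $\epsilon=(\epsilon_1,\dots,\epsilon_k)\in\{+,-\}^k$ the subgroup $U_\epsilon:=\bigcap_{i=1}^kU_{\alpha_i\epsilon_i}$ satisfies: for each $\alpha\in\mathcal{H}$, $\alpha(U_\epsilon)\le U_\epsilon$ or $\alpha(U_\epsilon)\ge U_\epsilon$. Then there exists a $U$-eigenfactor $E$ of $\mathcal{H}$ such that $\rho$ is associated with $\bigcup_{\alpha\in\mathcal{H}}\alpha(E)$.
   Context: $\mathrm{Aut}(G)$ is the group of bicontinuous automorphisms of $G$. For $\alpha\in\mathrm{Aut}(G)$ and a compact open subgroup $U\le G$, put $U_{\alpha+}=\bigcap_{n\ge0}\alpha^{n}(U)$ and $U_{\alpha-}=\bigcap_{n\ge0}\alpha^{-n}(U)$ (so $U_{\alpha-}=U_{\alpha^{-1}+}$). $U$ is tidy for $\alpha$ if $U=U_{\alpha+}U_{\alpha-}$ and $\bigcup_{n\ge0}\alpha^{-n}(U_{\alpha-})$ is closed. $U$ is tidy for a subgroup $\mathcal{H}\le\mathrm{Aut}(G)$ if it is tidy for every $\alpha\in\mathcal{H}$; $\mathcal{H}$ is flat if some compact open subgroup is tidy for $\mathcal{H}$. (It is known, by a result of Willis, that when $U$ is tidy for $\mathcal{H}$, $U$ is the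 product, in a suitable order, of the subgroups $U_\epsilon$, $\epsilon\in\{+,-\}^k$.) A subgroup $E\le U$ is a $U$-eigenfactor of $\mathcal{H}$ if for each $\alpha\in\mathcal{H}$ we have $\alpha(E)\le E$ or $\alpha(E)\ge E$, and $E=\bigcap_{\alpha\in\mathcal{H},\,\alpha(E)\ge E}\alpha(U)$. A closed, non-compact, $\mathcal{H}$-invariant subgroup $H\le G$ is a scaling subgroup for $\mathcal{H}$ if there is a compact, relatively open subgroup $V\le H$ with $H=\bigcup\{\alpha(V)\mid\alpha\in\mathcal{H}\}$ and such that for each $\alpha\in\mathcal{H}$ either $\alpha(V)\ge V$ or $\alpha(V)\le V$. A root of $\mathcal{H}$ is a surjective homomorphism $\rho:\mathcal{H}\to\mathbb{Z}$ for which there exist a scaling subgroup $H$ for $\mathcal{H}$ and an integer $s_\rho>1$ with $\Delta_H(\alpha|_H)=s_\rho^{\rho(\alpha)}$ for all $\alpha\in\mathcal{H}$, where $\Delta_H$ is the modular function on automorphisms of $H$ (the factor by which the automorphism scales Haar measure of $H$); one then says that $\rho$ is associated with the scaling subgroup $H$. $\Phi(\mathcal{H})$ is the set of roots of $\mathcal{H}$. *)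

theory Defs
  imports "HOL-Analysis.Analysis"
begin

text \<open>
  Topological groups are types of class \<^class>\<open>topological_group_add\<close>. Despite the additive
  notation, such groups need not be commutative; \<open>+\<close> is the group operation and \<open>0\<close> the identity.
\<close>

definition is_subgroup :: "'a::group_add set \<Rightarrow> bool" where
  "is_subgroup S \<longleftrightarrow> 0 \<in> S \<and> (\<forall>x\<in>S. \<forall>y\<in>S. x + y \<in> S) \<and> (\<forall>x\<in>S. - x \<in> S)"

definition totally_disconnected :: "'a::topological_space set \<Rightarrow> bool" where
  "totally_disconnected S \<longleftrightarrow> (\<forall>C\<subseteq>S. connected C \<longrightarrow> (\<exists>x. C \<subseteq> {x}))"

definition compact_open_subgroup :: "'a::topological_group_add set \<Rightarrow> bool" where
  "compact_open_subgroup U \<longleftrightarrow> is_subgroup U \<and> compact U \<and> open U"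


section \<open>Groups of automorphisms\<close>

definition Aut :: "('a::topological_group_add \<Rightarrow> 'a) set" where
  "Aut = {\<alpha>. bij \<alpha> \<and> (\<forall>x y. \<alpha> (x + y) = \<alpha> x + \<alpha> y) \<and>
              continuous_on UNIV \<alpha> \<and> continuous_on UNIV (inv \<alpha>)}"

definition subgroup_of_Aut :: "('a::topological_group_add \<Rightarrow> 'a) set \<Rightarrow> bool" where
  "subgroup_of_Aut \<H> \<longleftrightarrow> \<H> \<subseteq> Aut \<and> id \<in> \<H> \<and>
     (\<forall>\<alpha>\<in>\<H>. \<forall>\<beta>\<in>\<H>. \<alpha> \<circ> \<beta> \<in> \<H>) \<and> (\<forall>\<alpha>\<in>\<H>. inv \<alpha> \<in> \<H>)"


section \<open>Tidy subgroups and flat groups\<close>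

definition plus_part :: "('a \<Rightarrow> 'a) \<Rightarrow> 'a set \<Rightarrow> 'a set" where
  "plus_part \<alpha> U = (\<Inter>n::nat. (\<alpha> ^^ n) ` U)"

definition minus_part :: "('a \<Rightarrow> 'a) \<Rightarrow> 'a set \<Rightarrow> 'a set" where
  "minus_part \<alpha> U = (\<Inter>n::nat. (inv \<alpha> ^^ n) ` U)"

definition tidy :: "('a::topological_group_add \<Rightarrow> 'a) \<Rightarrow> 'a set \<Rightarrow> bool" where
  "tidy \<alpha> U \<longleftrightarrow> compact_open_subgroup U \<and>
     U = {x + y | x y. x \<in> plus_part \<alpha> U \<and> y \<in> minus_part \<alpha> U} \<and>
     closed (\<Union>n::nat. (inv \<alpha> ^^ n) ` minus_part \<alpha> U)"

definition tidy_for_group :: "('a::topological_group_add \<Rightarrow> 'a) set \<Rightarrow> 'a set \<Rightarrow> bool" where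
  "tidy_for_group \<H> U \<longleftrightarrow> (\<forall>\<alpha>\<in>\<H>. tidy \<alpha> U)"

definition flat :: "('a::topological_group_add \<Rightarrow> 'a) set \<Rightarrow> bool" where
  "flat \<H> \<longleftrightarrow> subgroup_of_Aut \<H> \<and> (\<exists>U. compact_open_subgroup U \<and> tidy_for_group \<H> U)"

definition eigenfactor :: "('a::topological_group_add \<Rightarrow> 'a) set \<Rightarrow> 'a set \<Rightarrow> 'a set \<Rightarrow> bool" where
  "eigenfactor \<H> U E \<longleftrightarrow> is_subgroup E \<and> E \<subseteq> U \<and>
     (\<forall>\<alpha>\<in>\<H>. \<alpha> ` E \<subseteq> E \<or> E \<subseteq> \<alpha> ` E) \<and>
     E = (\<Inter>\<alpha>\<in>{\<alpha>\<in>\<H>. E \<subseteq> \<alpha> ` E}. \<alpha> ` U)"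

text \<open>
  \<open>sign_part \<alpha>s k \<epsilon> U\<close> is \<open>U\<^sub>\<epsilon>\<close> for the automorphisms \<open>\<alpha>s 1, \<dots>, \<alpha>s k\<close>, where \<^const>\<open>True\<close> stands for
  the sign \<open>+\<close> and \<^const>\<open>False\<close> for \<open>-\<close>. All parts are contained in \<open>U\<close>, so intersecting with \<open>U\<close>
  only matters for \<open>k = 0\<close>, where the empty intersection of subgroups of \<open>U\<close> is \<open>U\<close>.
\<close>

definition sign_part :: "(nat \<Rightarrow> 'a \<Rightarrow> 'a) \<Rightarrow> nat \<Rightarrow> (nat \<Rightarrow> bool) \<Rightarrow> 'a set \<Rightarrow> 'a set" where
  "sign_part \<alpha>s k \<epsilon> U =
     U \<inter> (\<Inter>i\<in>{1..k}. if \<epsilon> i then plus_part (\<alpha>s i) U else minus_part (\<alpha>s i) U)"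


section \<open>Haar measure and the modular function\<close>

text \<open>A left Haar measure on a closed subgroup \<open>H\<close>: a nonzero left-invariant Radon measure on the
  Borel sets of the subspace \<open>H\<close>.\<close>

definition left_Haar_measure :: "'a::topological_group_add set \<Rightarrow> 'a measure \<Rightarrow> bool" where
  "left_Haar_measure H \<mu> \<longleftrightarrow>
     space \<mu> = H \<and> sets \<mu> = sets (restrict_space borel H) \<and>
     emeasure \<mu> H \<noteq> 0 \<and>
     (\<forall>x\<in>H. \<forall>B\<in>sets \<mu>. emeasure \<mu> ((+) x ` B) = emeasure \<mu> B) \<and>
     (\<forall>K\<subseteq>H. compact K \<longrightarrow> emeasure \<mu> K < \<infinity>) \<and>
     (\<forall>B\<in>sets \<mu>. emeasure \<mu> B =
        (INF W\<in>{W. openin (top_of_set H) W \<and> B \<subseteq> W}. emeasure \<mu> W)) \<and>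
     (\<forall>W. openin (top_of_set H) W \<longrightarrow> emeasure \<mu> W =
        (SUP K\<in>{K. compact K \<and> K \<subseteq> W}. emeasure \<mu> K))"

text \<open>\<open>modular H \<alpha>\<close> is \<open>\<Delta>\<^sub>H(\<alpha>|\<^sub>H)\<close>, for \<open>\<alpha>\<close> an automorphism of the ambient group
  with \<open>\<alpha>(H) = H\<close>.\<close>

definition modular :: "'a::topological_group_add set \<Rightarrow> ('a \<Rightarrow> 'a) \<Rightarrow> real" where
  "modular H \<alpha> = (THE c. 0 < c \<and>
     (\<forall>\<mu>. left_Haar_measure H \<mu> \<longrightarrow>
        (\<forall>B\<in>sets \<mu>. emeasure \<mu> (\<alpha> ` B) = ennreal c * emeasure \<mu> B)))"


section \<open>Scaling subgroups and roots\<close>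

definition scaling_subgroup :: "('a::topological_group_add \<Rightarrow> 'a) set \<Rightarrow> 'a set \<Rightarrow> bool" where
  "scaling_subgroup \<H> H \<longleftrightarrow>
     is_subgroup H \<and> closed H \<and> \<not> compact H \<and> (\<forall>\<alpha>\<in>\<H>. \<alpha> ` H = H) \<and>
     (\<exists>V. is_subgroup V \<and> compact V \<and> openin (top_of_set H) V \<and>
          H = (\<Union>\<alpha>\<in>\<H>. \<alpha> ` V) \<and> (\<forall>\<alpha>\<in>\<H>. V \<subseteq> \<alpha> ` V \<or> \<alpha> ` V \<subseteq> V))"

text \<open>Homomorphisms \<open>\<H> \<rightarrow> \<int>\<close> are represented by functions on all self-maps, of which only the
  values on \<open>\<H>\<close> matter.\<close>

definition surj_hom_to_int :: "('a \<Rightarrow> 'a) set \<Rightarrow> (('a \<Rightarrow> 'a) \<Rightarrow> int) \<Rightarrow> bool" where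
  "surj_hom_to_int \<H> \<rho> \<longleftrightarrow>
     (\<forall>\<alpha>\<in>\<H>. \<forall>\<beta>\<in>\<H>. \<rho> (\<alpha> \<circ> \<beta>) = \<rho> \<alpha> + \<rho> \<beta>) \<and> \<rho> ` \<H> = UNIV"

definition associated ::
  "('a::topological_group_add \<Rightarrow> 'a) set \<Rightarrow> (('a \<Rightarrow> 'a) \<Rightarrow> int) \<Rightarrow> 'a set \<Rightarrow> bool" where
  "associated \<H> \<rho> H \<longleftrightarrow> surj_hom_to_int \<H> \<rho> \<and> scaling_subgroup \<H> H \<and>
     (\<exists>s::int. s > 1 \<and> (\<forall>\<alpha>\<in>\<H>. modular H \<alpha> = of_int s powi \<rho> \<alpha>))"

definition roots :: "('a::topological_group_add \<Rightarrow> 'a) set \<Rightarrow> (('a \<Rightarrow> 'a) \<Rightarrow> int) set" where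
  "roots \<H> = {\<rho>. surj_hom_to_int \<H> \<rho> \<and> (\<exists>H. associated \<H> \<rho> H)}"

end

theory Submission
  imports Defs
begin

text \<open>
  Let \<open>H0\<close> be a scaling subgroup with which \<open>\<rho>\<close> is associated. Everything rests on one property of tidy
  subgroups (\<open>tidy_bounded_orbit\<close>): if \<open>U\<close> is tidy for \<open>\<alpha>\<close> and the forward \<open>\<alpha>\<close>-orbit of a point of \<open>U\<close>
  stays in a compact set, then it stays in \<open>U\<close>. Orbits in \<open>H0\<close> are bounded under every \<open>\<alpha>\<close> with
  \<open>\<rho> \<alpha> \<le> 0\<close>, so \<open>W = U \<inter> H0\<close> is contained in \<open>minus_part \<alpha> U\<close> if \<open>\<rho> \<alpha> \<le> 0\<close> and in \<open>plus_part \<alpha> U\<close> if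
  \<open>\<rho> \<alpha> \<ge> 0\<close>. Hence \<open>W\<close> lies in one of the sign parts \<open>U\<^sub>\<epsilon>\<close>.

  There are finitely many sign parts; let \<open>E\<close> be maximal among those that contain \<open>W\<close>. For every
  \<open>\<gamma> \<in> \<H>\<close> each \<open>\<alpha>s i\<close> either shrinks or enlarges \<open>\<gamma> ` E\<close>, because \<open>E\<close> is comparable with all its images.
  In the first case all forward orbits in \<open>\<gamma> ` E\<close> are bounded, in the second all backward orbits are,
  so \<open>\<gamma> ` E \<inter> U\<close> lies in a single sign part. If \<open>E \<subseteq> \<gamma> ` E\<close>, maximality forces both
  that sign part and \<open>\<gamma> ` E \<inter> U\<close> to be equal to \<open>E\<close>. For \<open>\<gamma> = id\<close> this says that \<open>E\<close> is the sign part whose signs record which \<open>\<alpha>s i\<close>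
  enlarge \<open>E\<close>; this makes \<open>E\<close> an eigenfactor. For general \<open>\<gamma>\<close> it says that the
  union \<open>H1\<close> of all \<open>\<gamma> ` E\<close> meets \<open>U\<close> exactly in \<open>E\<close>; so \<open>H1\<close> is closed and \<open>E\<close> is open in \<open>H1\<close>.

  It remains to compare the modular function of \<open>H1\<close> with \<open>\<rho>\<close>. If \<open>\<rho> \<alpha> > 0\<close>, then \<open>\<alpha>\<close> scales the Haar
  measure of \<open>H0\<close> by a factor greater than 1, so that \<open>W\<close> is not contained in any compact set that \<open>\<alpha>\<close>
  maps into itself. Hence \<open>\<alpha>\<close> enlarges \<open>E\<close> strictly, and its modulus on \<open>H1\<close> is greater than 1. Thus
  \<open>ln \<circ> modular H1\<close> is a homomorphism to the reals which is positive wherever \<open>\<rho>\<close> is. By the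
  Archimedean property it is a multiple of \<open>\<rho>\<close> (\<open>hom_proportional\<close>), that is, \<open>modular H1\<close> is a power
  \<open>t powi \<rho>\<close>. The base \<open>t\<close> is the value at some \<open>\<sigma>\<close> with \<open>\<rho> \<sigma> = 1\<close>, the index of \<open>E\<close> in
  \<open>\<sigma> ` E\<close>, which is an integer.

  All this presupposes Haar measure on \<open>H0\<close> and \<open>H1\<close>, which is constructed here for totally disconnected
  groups. By van Dantzig's theorem the compact open subgroups form a neighbourhood base of the identity,
  so compact open sets are measured by counting cosets of a sufficiently small open subgroup
  (\<open>content\<close>). Such a finitely additive content on the compact open subsets of a zero-dimensional space extends to a
  regular Borel measure (\<open>ex_regular_extension\<close>), and a regular measure is determined by its values on compact open sets
  (\<open>regular_unique\<close>).
\<close>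


section \<open>Cosets and compact open subgroups\<close>

lemma mem_translate: "y \<in> (+) x ` V \<longleftrightarrow> - x + y \<in> V" for x :: "'a::group_add"
proof
  assume "- x + y \<in> V"
  then show "y \<in> (+) x ` V" by (intro image_eqI[of _ _ "- x + y"]) (auto simp: add.assoc[symmetric])
qed (auto simp: add.assoc[symmetric])

lemma is_subgroupD:
  assumes "is_subgroup V"
  shows "0 \<in> V" "x \<in> V \<Longrightarrow> y \<in> V \<Longrightarrow> x + y \<in> V" "x \<in> V \<Longrightarrow> - x \<in> V"
  using assms by (auto simp: is_subgroup_def)

lemma coset_eq_iff:
  fixes V :: "'a::group_add set"
  assumes V: "is_subgroup V"
  shows "(+) x ` V = (+) y ` V \<longleftrightarrow> - x + y \<in> V"
proof
  assume "(+) x ` V = (+) y ` V"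
  moreover have "y \<in> (+) y ` V" using is_subgroupD(1)[OF V] by (auto intro!: image_eqI[of _ _ 0])
  ultimately show "- x + y \<in> V" using mem_translate by blast
next
  assume xy: "- x + y \<in> V"
  have "- x + z \<in> V \<longleftrightarrow> - y + z \<in> V" for z
  proof
    assume "- x + z \<in> V"
    from is_subgroupD(2)[OF V is_subgroupD(3)[OF V xy] this] show "- y + z \<in> V"
      by (simp add: minus_add add.assoc[symmetric])
  next
    assume "- y + z \<in> V"
    from is_subgroupD(2)[OF V xy this] show "- x + z \<in> V"
      by (metis add.assoc add.right_inverse add_0)
  qed
  then show "(+) x ` V = (+) y ` V" by (auto simp: mem_translate set_eq_iff)
qed

lemma translate_Int:
  fixes H :: "'a::group_add set"
  assumes "is_subgroup H" "x \<in> H"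
  shows "(+) x ` (H \<inter> T) = H \<inter> (+) x ` T"
proof -
  have "- x + y \<in> H \<longleftrightarrow> y \<in> H" for y
    using is_subgroupD[OF assms(1)] assms(2) by (metis add.assoc add.right_inverse add_0)
  then show ?thesis by (auto simp: mem_translate set_eq_iff)
qed

lemma translate_subgroup:
  fixes H :: "'a::group_add set"
  assumes "is_subgroup H" "x \<in> H"
  shows "(+) x ` H = H"
  using translate_Int[OF assms, of UNIV] by (auto simp: surj_plus)

lemma continuous_on_translate: "continuous_on S ((+) (x::'a::topological_group_add))"
  by (intro continuous_intros)

lemma open_translate:
  fixes V :: "'a::topological_group_add set"
  assumes "open V" shows "open ((+) x ` V)"
proof -
  have "(+) x ` V = (\<lambda>y. - x + y) -` V" by (auto simp: mem_translate)
  then show ?thesis by (metis assms continuous_on_translate open_vimage)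
qed

lemma compact_translate:
  fixes V :: "'a::topological_group_add set"
  shows "compact V \<Longrightarrow> compact ((+) x ` V)"
  by (rule compact_continuous_image[OF continuous_on_translate])

lemma openin_translate:
  fixes H :: "'a::topological_group_add set"
  assumes "is_subgroup H" "x \<in> H" "openin (top_of_set H) W"
  shows "openin (top_of_set H) ((+) x ` W)"
proof -
  obtain T where "open T" "W = H \<inter> T" using assms(3) unfolding openin_open by metis
  then show ?thesis using translate_Int[OF assms(1,2)] open_translate by (metis openin_open)
qed

text \<open>The tube lemma for the addition map.\<close>

lemma compact_plus_nhd:
  fixes C :: "'a::topological_group_add set"
  assumes "compact C" "open S" "C \<subseteq> S"
  obtains N where "open N" "0 \<in> N" "\<And>x n. x \<in> C \<Longrightarrow> n \<in> N \<Longrightarrow> x + n \<in> S"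
proof -
  have op: "open ((\<lambda>p::'a\<times>'a. fst p + snd p) -` S)"
    by (intro open_vimage assms continuous_intros)
  have "\<exists>A B. open A \<and> open B \<and> x \<in> A \<and> 0 \<in> B \<and> (\<forall>a\<in>A. \<forall>b\<in>B. a + b \<in> S)" if "x \<in> C" for x
  proof -
    have x0: "(x, 0) \<in> (\<lambda>p. fst p + snd p) -` S" using that assms by auto
    obtain A B where "open A" "open B" "(x, 0) \<in> A \<times> B" "A \<times> B \<subseteq> (\<lambda>p. fst p + snd p) -` S"
      by (rule open_prod_elim[OF op x0])
    then show ?thesis by (intro exI[of _ A] exI[of _ B]) force
  qed
  then obtain A B where AB: "\<And>x. x \<in> C \<Longrightarrow> open (A x) \<and> open (B x) \<and> x \<in> A x \<and> 0 \<in> B x \<and> (\<forall>a\<in>A x. \<forall>b\<in>B x. a + b \<in> S)"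
    by metis
  obtain D where D: "D \<subseteq> C" "finite D" "C \<subseteq> (\<Union>x\<in>D. A x)"
    using compactE_image[OF assms(1), of C A] AB by blast
  show thesis
  proof (rule that[of "\<Inter>x\<in>D. B x"])
    show "open (\<Inter>x\<in>D. B x)" using AB D by (intro open_INT) auto
    show "0 \<in> (\<Inter>x\<in>D. B x)" using AB D by auto
    show "x + n \<in> S" if xn: "x \<in> C" "n \<in> (\<Inter>x\<in>D. B x)" for x n
    proof -
      obtain y where y: "y \<in> D" "x \<in> A y" using xn(1) D(3) by blast
      then have "n \<in> B y" "y \<in> C" using xn(2) D(1) by auto
      then show ?thesis using AB[of y] y(2) by simp
    qed
  qed
qed

lemma open_subgroup_closed:
  fixes V :: "'a::topological_group_add set"
  assumes "is_subgroup V" "open V"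
  shows "closed V"
proof -
  have "- V = (\<Union>x\<in>- V. (+) x ` V)"
  proof safe
    fix x assume "x \<notin> V" then show "x \<in> (\<Union>x\<in>- V. (+) x ` V)"
      using is_subgroupD(1)[OF assms(1)] by (force simp: mem_translate)
  next
    fix x v assume "x \<notin> V" "v \<in> V" "x + v \<in> V"
    have "(x + v) + (- v) \<in> V"
      by (rule is_subgroupD(2)[OF assms(1) \<open>x + v \<in> V\<close> is_subgroupD(3)[OF assms(1) \<open>v \<in> V\<close>]])
    with \<open>x \<notin> V\<close> show False by (simp add: add.assoc)
  qed
  then have "open (- V)" using open_translate[OF assms(2)] by (metis (no_types, lifting) open_UN)
  then show ?thesis by (simp add: closed_def)
qed

text \<open>Components are points, so a locally compact Hausdorff space without larger components has a compact
  open neighbourhood \<open>C\<close> of \<open>0\<close> inside \<open>S \<inter> U\<close>. The elements that stabilise \<open>C\<close> under right translation form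
  a subgroup; it lies in \<open>C\<close> because \<open>0 \<in> C\<close>, and it is open by compactness of \<open>C\<close>.\<close>

lemma van_Dantzig:
  fixes U :: "'a::{topological_group_add,t2_space} set"
  assumes td: "totally_disconnected (UNIV::'a set)" and U: "compact_open_subgroup U"
    and S: "open S" "0 \<in> S"
  obtains V where "compact_open_subgroup V" "V \<subseteq> U" "V \<subseteq> S"
proof -
  have U': "is_subgroup U" "compact U" "open U" "0 \<in> U"
    using U is_subgroupD(1) by (auto simp: compact_open_subgroup_def)
  have lc: "locally_compact_space (euclidean::'a topology)"
    unfolding locally_compact_space_def
  proof safe
    fix x :: 'a
    have "x \<in> (+) x ` U" using U' by (simp add: mem_translate)
    then show "\<exists>A K. openin euclidean A \<and> compactin euclidean K \<and> x \<in> A \<and> A \<subseteq> K"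
      using open_translate[OF U'(3), of x] compact_translate[OF U'(2), of x]
      by (auto simp: compactin_euclidean_iff)
  qed
  have haus: "Hausdorff_space (euclidean::'a topology)"
    unfolding Hausdorff_space_def disjnt_def using hausdorff by fastforce
  have comp: "{0::'a} \<in> connected_components_of euclidean"
  proof -
    have "connected_component_of_set euclidean (0::'a) \<subseteq> {0}"
    proof -
      have "connected (connected_component_of_set euclidean (0::'a))"
        using connectedin_connected_component_of connectedin_iff_connected by metis
      then obtain y where "connected_component_of_set euclidean (0::'a) \<subseteq> {y}"
        using td unfolding totally_disconnected_def by (metis subset_UNIV)
      moreover have "0 \<in> connected_component_of_set euclidean (0::'a)"
        by (simp add: connected_component_of_refl)
      ultimately show ?thesis by blast
    qed
    then have "connected_component_of_set euclidean (0::'a) = {0}"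
      by (auto simp: connected_component_of_refl)
    then show ?thesis by (metis connected_component_in_connected_components_of UNIV_I topspace_euclidean)
  qed
  obtain C D where C: "open C" "open D" "disjnt C D" "C \<union> D = UNIV" "{0} \<subseteq> C" "C \<subseteq> S \<inter> U"
    using wilder_locally_compact_component_thm[OF lc haus comp, of "S \<inter> U"] S U'
    by (auto simp: compactin_euclidean_iff)
  have "- C = D" using C(3,4) by (auto simp: disjnt_def)
  then have "closed C" using C(2) by (simp add: closed_def)
  then have "compact C" using U' C by (metis compact_Int_closed inf.absorb_iff2 le_inf_iff)
  then obtain N where N: "open N" "0 \<in> N" "\<And>x n. x \<in> C \<Longrightarrow> n \<in> N \<Longrightarrow> x + n \<in> C"
    using compact_plus_nhd[OF _ C(1), of C] by blast
  define M where "M = N \<inter> uminus -` N"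
  have M: "open M" "0 \<in> M" using N by (auto simp: M_def intro!: open_Int open_vimage continuous_intros)
  define V where "V = {v. \<forall>x. x + v \<in> C \<longleftrightarrow> x \<in> C}"
  have sub: "is_subgroup V" unfolding is_subgroup_def
  proof safe
    show "0 \<in> V" by (simp add: V_def)
    show "x + y \<in> V" if "x \<in> V" "y \<in> V" for x y using that by (simp add: V_def add.assoc[symmetric])
    show "- x \<in> V" if "x \<in> V" for x
      unfolding V_def
    proof safe
      fix z
      have *: "(z + - x) + x \<in> C \<longleftrightarrow> z + - x \<in> C" using that V_def by blast
      have "(z + - x) + x = z" by (simp add: add.assoc)
      with * show "z + - x \<in> C \<Longrightarrow> z \<in> C" "z \<in> C \<Longrightarrow> z + - x \<in> C" by auto
    qed
  qed
  have "M \<subseteq> V"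
  proof
    fix m assume m: "m \<in> M"
    have "x \<in> C" if "x + m \<in> C" for x
      using N(3)[OF that, of "- m"] m by (auto simp: M_def add.assoc)
    then show "m \<in> V" using m N(3) unfolding V_def M_def by blast
  qed
  have "V = (\<Union>v\<in>V. (+) v ` M)"
    using M(2) \<open>M \<subseteq> V\<close> is_subgroupD(2)[OF sub] by (force simp: mem_translate)
  then have "open V" using open_translate[OF M(1)] by (metis (no_types, lifting) open_UN)
  have "V \<subseteq> C"
  proof
    fix v assume "v \<in> V" then have "0 + v \<in> C" using C(5) unfolding V_def by blast
    then show "v \<in> C" by simp
  qed
  have "compact V" using open_subgroup_closed[OF sub \<open>open V\<close>] \<open>compact C\<close> \<open>V \<subseteq> C\<close>
    by (metis compact_Int_closed inf.absorb_iff2)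
  show thesis using that[of V] sub \<open>open V\<close> \<open>compact V\<close> \<open>V \<subseteq> C\<close> C(6)
    by (auto simp: compact_open_subgroup_def)
qed

definition compact_opens :: "'a::topological_space set \<Rightarrow> 'a set set" where
  "compact_opens H = {C. compact C \<and> openin (top_of_set H) C}"

lemma compact_opensD: "C \<in> compact_opens H \<Longrightarrow> compact C" "C \<in> compact_opens H \<Longrightarrow> openin (top_of_set H) C"
  "C \<in> compact_opens H \<Longrightarrow> C \<subseteq> H"
  by (auto simp: compact_opens_def dest: openin_imp_subset)

lemma compact_opensE:
  assumes "C \<in> compact_opens H"
  obtains T where "open T" "C = H \<inter> T"
  using compact_opensD(2)[OF assms] unfolding openin_open by metis

lemma compact_opens_ring:
  fixes H :: "'a::t2_space set"
  shows "{} \<in> compact_opens H"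
    "C \<in> compact_opens H \<Longrightarrow> D \<in> compact_opens H \<Longrightarrow> C \<union> D \<in> compact_opens H"
    "C \<in> compact_opens H \<Longrightarrow> D \<in> compact_opens H \<Longrightarrow> C \<inter> D \<in> compact_opens H"
    "C \<in> compact_opens H \<Longrightarrow> D \<in> compact_opens H \<Longrightarrow> C - D \<in> compact_opens H"
proof -
  show "{} \<in> compact_opens H" by (auto simp: compact_opens_def)
  assume C: "C \<in> compact_opens H" and D: "D \<in> compact_opens H"
  then show "C \<union> D \<in> compact_opens H" "C \<inter> D \<in> compact_opens H"
    by (auto simp: compact_opens_def intro!: compact_Un compact_Int)
  obtain T where T: "open T" "D = H \<inter> T" using compact_opensE[OF D] .
  have "C - D = C \<inter> (- T)" using T compact_opensD(3)[OF C] by auto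
  then have "compact (C - D)" using T compact_opensD(1)[OF C] by (simp add: compact_Int_closed closed_Compl)
  moreover have "C - D = C \<inter> (- D)" by auto
  then have "openin (top_of_set H) (C - D)"
    using compact_opensD(1)[OF D] compact_opensD(2)[OF C] by (simp add: compact_imp_closed openin_Int_open open_Compl)
  ultimately show "C - D \<in> compact_opens H" by (simp add: compact_opens_def)
qed

section \<open>Counting cosets\<close>

text \<open>A totally disconnected, locally compact group \<open>H\<close>, realised inside the ambient topological group, with a
  compact open subgroup \<open>E\<close> that serves to normalise the content. Van Dantzig's theorem enters through
  \<open>base\<close>; see \<open>tdlc_group_closed_subgroup\<close>.\<close>

locale tdlc_group =
  fixes H E :: "'a::{topological_group_add,t2_space} set"
  assumes H: "is_subgroup H"
    and E: "is_subgroup E" "E \<in> compact_opens H"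
    and base: "\<And>S. openin (top_of_set H) S \<Longrightarrow> 0 \<in> S \<Longrightarrow>
       \<exists>V. is_subgroup V \<and> V \<in> compact_opens H \<and> V \<subseteq> E \<and> V \<subseteq> S"
begin

definition open_subgroups :: "'a set set" where
  "open_subgroups = {V. is_subgroup V \<and> V \<in> compact_opens H \<and> V \<subseteq> E}"

definition num_cosets :: "'a set \<Rightarrow> 'a set \<Rightarrow> nat" where
  "num_cosets V C = card ((\<lambda>x. (+) x ` V) ` C)"

definition stable :: "'a set \<Rightarrow> 'a set \<Rightarrow> bool" where
  "stable V C \<longleftrightarrow> (\<forall>x\<in>C. \<forall>v\<in>V. x + v \<in> C)"

lemma open_subgroupsD: "V \<in> open_subgroups \<Longrightarrow> is_subgroup V" "V \<in> open_subgroups \<Longrightarrow> V \<in> compact_opens H" "V \<in> open_subgroups \<Longrightarrow> V \<subseteq> E" "V \<in> open_subgroups \<Longrightarrow> V \<subseteq> H"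
  by (auto simp: open_subgroups_def dest: compact_opensD)

lemma E_open_subgroups: "E \<in> open_subgroups" using E by (auto simp: open_subgroups_def)

lemma Int_open_subgroups: "V \<in> open_subgroups \<Longrightarrow> W \<in> open_subgroups \<Longrightarrow> V \<inter> W \<in> open_subgroups"
  by (auto simp: open_subgroups_def compact_opens_ring is_subgroup_def)

lemma stable_mono: "stable V C \<Longrightarrow> W \<subseteq> V \<Longrightarrow> stable W C"
  by (auto simp: stable_def)

lemma stable_subgroup: "is_subgroup E' \<Longrightarrow> V \<subseteq> E' \<Longrightarrow> stable V E'"
  unfolding stable_def by (blast intro: is_subgroupD(2))

lemma translate_compact_opens:
  "C \<in> compact_opens H \<Longrightarrow> x \<in> H \<Longrightarrow> (+) x ` C \<in> compact_opens H"
  using openin_translate[OF H] compact_translate by (auto simp: compact_opens_def)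

lemma finite_cosets:
  assumes "compact C" "C \<subseteq> H" "V \<in> open_subgroups"
  shows "finite ((\<lambda>x. (+) x ` V) ` C)"
proof -
  obtain T where T: "open T" "V = H \<inter> T" using compact_opensE[OF open_subgroupsD(2)[OF assms(3)]] .
  have 0: "0 \<in> V" using open_subgroupsD(1)[OF assms(3)] is_subgroupD(1) by blast
  have "C \<subseteq> (\<Union>x\<in>C. (+) x ` T)" using 0 T by (force simp: mem_translate)
  then obtain D where D: "D \<subseteq> C" "finite D" "C \<subseteq> (\<Union>x\<in>D. (+) x ` T)"
    using compactE_image[OF assms(1), of C "\<lambda>x. (+) x ` T"] open_translate[OF T(1)] by blast
  have "(\<lambda>x. (+) x ` V) ` C \<subseteq> (\<lambda>x. (+) x ` V) ` D"
  proof
    fix X assume "X \<in> (\<lambda>x. (+) x ` V) ` C"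
    then obtain y where y: "y \<in> C" "X = (+) y ` V" by blast
    then obtain x where x: "x \<in> D" "- x + y \<in> T" using D by (auto simp: mem_translate)
    have "x \<in> H" "y \<in> H" using x y D(1) assms(2) by auto
    then have "- x + y \<in> H" using is_subgroupD(2)[OF H is_subgroupD(3)[OF H]] by blast
    then have "- x + y \<in> V" using T x by blast
    then have "(+) x ` V = X" using coset_eq_iff[OF open_subgroupsD(1)[OF assms(3)]] y by blast
    then show "X \<in> (\<lambda>x. (+) x ` V) ` D" using x by blast
  qed
  then show ?thesis using finite_imageI[OF D(2)] by (rule finite_subset)
qed

lemma num_cosets_pos: "V \<in> open_subgroups \<Longrightarrow> compact C \<Longrightarrow> C \<subseteq> H \<Longrightarrow> C \<noteq> {} \<Longrightarrow> num_cosets V C > 0"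
  unfolding num_cosets_def card_gt_0_iff using finite_cosets[of C V] by blast

lemma ex_stable:
  assumes "C \<in> compact_opens H"
  shows "\<exists>V\<in>open_subgroups. stable V C"
proof -
  obtain T where T: "open T" "C = H \<inter> T" using compact_opensE[OF assms] .
  have CT: "C \<subseteq> T" using T(2) by blast
  obtain N where N: "open N" "0 \<in> N" "\<And>x n. x \<in> C \<Longrightarrow> n \<in> N \<Longrightarrow> x + n \<in> T"
    using compact_plus_nhd[OF compact_opensD(1)[OF assms] T(1) CT] by metis
  have "openin (top_of_set H) (H \<inter> N)" using N(1) by (rule openin_open_Int)
  moreover have "0 \<in> H \<inter> N" using is_subgroupD(1)[OF H] N(2) by blast
  ultimately obtain V where V: "is_subgroup V \<and> V \<in> compact_opens H \<and> V \<subseteq> E \<and> V \<subseteq> H \<inter> N"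
    using base by metis
  have "x + v \<in> C" if "x \<in> C" "v \<in> V" for x v
  proof -
    have "x \<in> H" "v \<in> H" "v \<in> N" using that T(2) V by auto
    then show ?thesis using N(3)[OF that(1)] is_subgroupD(2)[OF H] T(2) by blast
  qed
  then have "stable V C" by (simp add: stable_def)
  moreover have "V \<in> open_subgroups" using V by (simp add: open_subgroups_def)
  ultimately show ?thesis by blast
qed

lemma num_cosets_mult:
  assumes V: "V \<in> open_subgroups" and W: "W \<in> open_subgroups" "W \<subseteq> V" and C: "compact C" "C \<subseteq> H" "stable V C"
  shows "num_cosets W C = num_cosets V C * num_cosets W V"
proof -
  define X where "X = (\<lambda>x. (+) x ` V) ` C"
  have Vs: "is_subgroup V" using V open_subgroupsD by blast
  have Ws: "is_subgroup W" using W open_subgroupsD by blast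
  have CX: "C = \<Union>X"
    using is_subgroupD(1)[OF Vs] C(3) by (force simp: X_def mem_translate stable_def)
  have XC: "A \<subseteq> C" if "A \<in> X" for A using that CX by blast
  have "(\<lambda>x. (+) x ` W) ` C = (\<Union>A\<in>X. (\<lambda>x. (+) x ` W) ` A)" using CX by blast
  moreover have "card (\<Union>A\<in>X. (\<lambda>x. (+) x ` W) ` A) = (\<Sum>A\<in>X. card ((\<lambda>x. (+) x ` W) ` A))"
  proof (rule card_UN_disjoint)
    show "finite X" unfolding X_def by (rule finite_cosets[OF C(1,2) V])
    show "\<forall>A\<in>X. finite ((\<lambda>x. (+) x ` W) ` A)"
      using finite_cosets[OF C(1,2) W(1)] XC by (meson finite_subset image_mono)
    show "\<forall>A\<in>X. \<forall>B\<in>X. A \<noteq> B \<longrightarrow> (\<lambda>x. (+) x ` W) ` A \<inter> (\<lambda>x. (+) x ` W) ` B = {}"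
    proof (intro ballI impI equals0I)
      fix A B Y assume AB: "A \<in> X" "B \<in> X" "A \<noteq> B" and "Y \<in> (\<lambda>x. (+) x ` W) ` A \<inter> (\<lambda>x. (+) x ` W) ` B"
      then obtain a b where ab: "a \<in> A" "b \<in> B" "(+) a ` W = (+) b ` W" by auto
      then have "- a + b \<in> W" using coset_eq_iff[OF Ws] by blast
      then have abV: "(+) a ` V = (+) b ` V" using coset_eq_iff[OF Vs] W(2) by blast
      have eq: "(+) d ` V = D" if D: "D \<in> X" "d \<in> D" for d D
      proof -
        obtain x where x: "D = (+) x ` V" using D(1) X_def by blast
        then have "- x + d \<in> V" using D(2) mem_translate by blast
        then show ?thesis using x coset_eq_iff[OF Vs] by blast
      qed
      have "(+) a ` V = A" "(+) b ` V = B" using eq AB ab by blast+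
      with abV show False using AB(3) by simp
    qed
  qed
  moreover have "card ((\<lambda>x. (+) x ` W) ` A) = num_cosets W V" if A: "A \<in> X" for A
  proof -
    obtain x where x: "A = (+) x ` V" using A X_def by blast
    have "(\<lambda>x. (+) x ` W) ` A = (\<lambda>S. (+) x ` S) ` ((\<lambda>x. (+) x ` W) ` V)"
      unfolding x image_image by (simp add: add.assoc)
    moreover have "inj_on (\<lambda>S. (+) x ` S) ((\<lambda>x. (+) x ` W) ` V)"
      by (auto simp: inj_on_def inj_image_eq_iff)
    ultimately show ?thesis by (simp add: num_cosets_def card_image)
  qed
  ultimately show ?thesis by (simp add: num_cosets_def X_def)
qed

text \<open>The filter of sufficiently small open subgroups. Coset counts relative to \<open>E\<close> are eventually constant along
  it, and any finite number of stability requirements hold eventually, so no common refinement has to be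
  chosen by hand.\<close>

definition small :: "'a set filter" where
  "small = (INF V\<in>open_subgroups. principal {W\<in>open_subgroups. W \<subseteq> V})"

lemma eventually_small: "eventually P small \<longleftrightarrow> (\<exists>V\<in>open_subgroups. \<forall>W\<in>open_subgroups. W \<subseteq> V \<longrightarrow> P W)"
proof -
  have "eventually P small \<longleftrightarrow> (\<exists>b\<in>open_subgroups. eventually P (principal {W \<in> open_subgroups. W \<subseteq> b}))"
    unfolding small_def
  proof (rule eventually_INF_base)
    show "open_subgroups \<noteq> {}" using E_open_subgroups by blast
    fix a b assume "a \<in> open_subgroups" "b \<in> open_subgroups"
    then show "\<exists>x\<in>open_subgroups. principal {W \<in> open_subgroups. W \<subseteq> x} \<le> inf (principal {W \<in> open_subgroups. W \<subseteq> a}) (principal {W \<in> open_subgroups. W \<subseteq> b})"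
      by (intro bexI[of _ "a \<inter> b"] Int_open_subgroups) auto
  qed
  then show ?thesis unfolding eventually_principal by blast
qed

lemma small_not_bot: "small \<noteq> bot"
proof -
  have "\<not> eventually (\<lambda>_. False) small" by (auto simp: eventually_small)
  then show ?thesis by (auto simp: trivial_limit_def)
qed

definition content :: "'a set \<Rightarrow> real" where
  "content C = Lim small (\<lambda>V. real (num_cosets V C) / real (num_cosets V E))"

lemma eventually_content:
  assumes C: "C \<in> compact_opens H"
  shows "eventually (\<lambda>V. V \<in> open_subgroups \<and> stable V C \<and> content C = real (num_cosets V C) / real (num_cosets V E)) small"
proof -
  obtain V where V: "V \<in> open_subgroups" "stable V C" using ex_stable[OF C] by blast
  define r where "r = real (num_cosets V C) / real (num_cosets V E)"
  have *: "real (num_cosets W C) / real (num_cosets W E) = r" if W: "W \<in> open_subgroups" "W \<subseteq> V" for W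
  proof -
    have "num_cosets W C = num_cosets V C * num_cosets W V"
      using num_cosets_mult[OF V(1) W compact_opensD(1)[OF C] compact_opensD(3)[OF C] V(2)] .
    moreover have "num_cosets W E = num_cosets V E * num_cosets W V"
      using num_cosets_mult[OF V(1) W compact_opensD(1)[OF E(2)] compact_opensD(3)[OF E(2)]
        stable_subgroup[OF E(1) open_subgroupsD(3)[OF V(1)]]] .
    moreover have "V \<noteq> {}" using is_subgroupD(1)[OF open_subgroupsD(1)[OF V(1)]] by blast
    then have "num_cosets W V > 0"
      using num_cosets_pos[OF W(1) compact_opensD(1)[OF open_subgroupsD(2)[OF V(1)]] open_subgroupsD(4)[OF V(1)]] by blast
    ultimately show ?thesis by (simp add: r_def)
  qed
  then have "eventually (\<lambda>W. real (num_cosets W C) / real (num_cosets W E) = r) small"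
    unfolding eventually_small using V(1) by blast
  then have "((\<lambda>W. real (num_cosets W C) / real (num_cosets W E)) \<longlongrightarrow> r) small" by (rule tendsto_eventually)
  then have "content C = r" unfolding content_def using small_not_bot by (rule tendsto_Lim[rotated])
  then show ?thesis using * V(1) stable_mono[OF V(2)] unfolding eventually_small
    by (intro bexI[OF _ V(1)]) auto
qed

lemma content_nonneg: "C \<in> compact_opens H \<Longrightarrow> content C \<ge> 0"
  using eventually_content[of C] small_not_bot
  by (metis (mono_tags, lifting) divide_nonneg_nonneg eventually_happens' of_nat_0_le_iff)

lemma content_pos:
  assumes "C \<in> compact_opens H" "C \<noteq> {}" shows "content C > 0"
proof -
  obtain V where V: "V \<in> open_subgroups" "content C = real (num_cosets V C) / real (num_cosets V E)"
    using eventually_content[OF assms(1)] small_not_bot by (metis (mono_tags, lifting) eventually_happens')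
  have "E \<noteq> {}" using is_subgroupD(1)[OF E(1)] by blast
  then have "num_cosets V E > 0" "num_cosets V C > 0"
    using num_cosets_pos[OF V(1)] compact_opensD[OF assms(1)] compact_opensD[OF E(2)] assms(2) by simp_all
  then show ?thesis using V(2) by simp
qed

lemma content_E: "content E = 1"
proof -
  obtain V where V: "V \<in> open_subgroups" "content E = real (num_cosets V E) / real (num_cosets V E)"
    using eventually_content[OF E(2)] small_not_bot by (metis (mono_tags, lifting) eventually_happens')
  have "E \<noteq> {}" using is_subgroupD(1)[OF E(1)] by blast
  then have "num_cosets V E > 0" using num_cosets_pos[OF V(1)] compact_opensD[OF E(2)] by simp
  then show ?thesis using V(2) by simp
qed

lemma content_Un:
  assumes C: "C \<in> compact_opens H" and D: "D \<in> compact_opens H" and "C \<inter> D = {}"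
  shows "content (C \<union> D) = content C + content D"
proof -
  have CD: "C \<union> D \<in> compact_opens H" using C D compact_opens_ring by blast
  have "\<exists>V. (V \<in> open_subgroups \<and> stable V C \<and> content C = real (num_cosets V C) / real (num_cosets V E)) \<and>
     (V \<in> open_subgroups \<and> stable V D \<and> content D = real (num_cosets V D) / real (num_cosets V E)) \<and>
     (V \<in> open_subgroups \<and> stable V (C \<union> D) \<and> content (C \<union> D) = real (num_cosets V (C \<union> D)) / real (num_cosets V E))"
    using eventually_conj[OF eventually_content[OF C] eventually_conj[OF eventually_content[OF D] eventually_content[OF CD]]]
      small_not_bot by (rule eventually_happens'[rotated])
  then obtain V where V: "V \<in> open_subgroups" "stable V C" "stable V D" "content C = real (num_cosets V C) / real (num_cosets V E)"
     "content D = real (num_cosets V D) / real (num_cosets V E)" "content (C \<union> D) = real (num_cosets V (C \<union> D)) / real (num_cosets V E)" by blast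
  have "num_cosets V (C \<union> D) = num_cosets V C + num_cosets V D"
    unfolding num_cosets_def image_Un
  proof (rule card_Un_disjoint)
    show "finite ((\<lambda>x. (+) x ` V) ` C)" "finite ((\<lambda>x. (+) x ` V) ` D)"
      using compact_opensD[OF C] compact_opensD[OF D] finite_cosets[OF _ _ V(1)] by simp_all
    show "(\<lambda>x. (+) x ` V) ` C \<inter> (\<lambda>x. (+) x ` V) ` D = {}"
    proof (intro equals0I)
      fix Y assume "Y \<in> (\<lambda>x. (+) x ` V) ` C \<inter> (\<lambda>x. (+) x ` V) ` D"
      then obtain a b where ab: "a \<in> C" "b \<in> D" "(+) a ` V = (+) b ` V" by auto
      then have "- a + b \<in> V" using coset_eq_iff[OF open_subgroupsD(1)[OF V(1)]] by blast
      then have "a + (- a + b) \<in> C" using V(2) ab(1) unfolding stable_def by blast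
      then show False using ab(2) assms(3) by auto
    qed
  qed
  then show ?thesis using V by (simp add: add_divide_distrib)
qed

lemma content_translate:
  assumes C: "C \<in> compact_opens H" and x: "x \<in> H"
  shows "content ((+) x ` C) = content C"
proof -
  have xC: "(+) x ` C \<in> compact_opens H" using translate_compact_opens C x by blast
  have "\<exists>V. (V \<in> open_subgroups \<and> stable V C \<and> content C = real (num_cosets V C) / real (num_cosets V E)) \<and>
     (V \<in> open_subgroups \<and> stable V ((+) x ` C) \<and> content ((+) x ` C) = real (num_cosets V ((+) x ` C)) / real (num_cosets V E))"
    using eventually_conj[OF eventually_content[OF C] eventually_content[OF xC]]
      small_not_bot by (rule eventually_happens'[rotated])
  then obtain V where V: "content C = real (num_cosets V C) / real (num_cosets V E)"
    "content ((+) x ` C) = real (num_cosets V ((+) x ` C)) / real (num_cosets V E)" by blast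
  have "(\<lambda>x. (+) x ` V) ` ((+) x ` C) = (\<lambda>S. (+) x ` S) ` ((\<lambda>x. (+) x ` V) ` C)"
    unfolding image_image by (simp add: add.assoc)
  moreover have "inj_on (\<lambda>S. (+) x ` S) ((\<lambda>x. (+) x ` V) ` C)"
    by (auto simp: inj_on_def inj_image_eq_iff)
  ultimately have "num_cosets V ((+) x ` C) = num_cosets V C" by (simp add: num_cosets_def card_image)
  then show ?thesis using V by simp
qed

text \<open>Specialising the count to cosets of \<open>E\<close> itself shows that contents of \<open>E\<close>-stable sets are integers.\<close>

lemma content_eq_num_cosets:
  assumes D: "D \<in> compact_opens H" and st: "stable E D"
  shows "content D = real (num_cosets E D)"
proof -
  obtain V where V: "V \<in> open_subgroups" "content D = real (num_cosets V D) / real (num_cosets V E)"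
    using eventually_content[OF D] small_not_bot by (metis (mono_tags, lifting) eventually_happens')
  have "num_cosets V D = num_cosets E D * num_cosets V E"
    by (rule num_cosets_mult[OF E_open_subgroups V(1) open_subgroupsD(3)[OF V(1)] compact_opensD(1)[OF D] compact_opensD(3)[OF D] st])
  moreover have "num_cosets V E > 0"
    using num_cosets_pos[OF V(1) compact_opensD(1)[OF E(2)] compact_opensD(3)[OF E(2)]] is_subgroupD(1)[OF E(1)] by blast
  ultimately show ?thesis using V(2) by simp
qed

end

section \<open>Regular measures on zero-dimensional spaces\<close>

lemma compact_opens_UN:
  fixes X :: "'a::t2_space set"
  assumes "finite I" "\<And>i. i \<in> I \<Longrightarrow> C i \<in> compact_opens X"
  shows "(\<Union>i\<in>I. C i) \<in> compact_opens X"
  using assms by (induction I) (auto intro: compact_opens_ring)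

text \<open>Regularity of a Radon measure, for an arbitrary set function, so that it also applies to the pullback
  of a measure under an automorphism. The last clause is the only instance of monotonicity required.\<close>

definition regular :: "'a::topological_space set \<Rightarrow> 'a set set \<Rightarrow> ('a set \<Rightarrow> ennreal) \<Rightarrow> bool" where
  "regular H \<B> f \<longleftrightarrow>
    (\<forall>B\<in>\<B>. f B = (INF W\<in>{W. openin (top_of_set H) W \<and> B \<subseteq> W}. f W)) \<and>
    (\<forall>W. openin (top_of_set H) W \<longrightarrow> f W = (SUP K\<in>{K. compact K \<and> K \<subseteq> W}. f K)) \<and>
    (\<forall>K C. compact K \<longrightarrow> K \<subseteq> C \<longrightarrow> C \<in> compact_opens H \<longrightarrow> f K \<le> f C)"

locale zero_dimensional =
  fixes X :: "'a::t2_space set"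
  assumes zero_dim: "\<And>S x. openin (top_of_set X) S \<Longrightarrow> x \<in> S \<Longrightarrow> \<exists>C\<in>compact_opens X. x \<in> C \<and> C \<subseteq> S"
begin

lemma compact_cover:
  assumes K: "compact K" and KS: "K \<subseteq> (\<Union>i. S i)" and S: "\<And>i. openin (top_of_set X) (S i)"
  shows "\<exists>(D::'a set) f P. finite D \<and> (\<forall>x\<in>D. P x \<in> compact_opens X \<and> P x \<subseteq> S (f x)) \<and> K \<subseteq> (\<Union>x\<in>D. P x)"
proof -
  have "\<exists>i C. C \<in> compact_opens X \<and> x \<in> C \<and> C \<subseteq> S i" if x: "x \<in> K" for x
  proof -
    obtain i where "x \<in> S i" using KS x by blast
    then show ?thesis using zero_dim[OF S] by blast
  qed
  then obtain f P where P: "\<And>x. x \<in> K \<Longrightarrow> P x \<in> compact_opens X \<and> x \<in> P x \<and> P x \<subseteq> S (f x)" by metis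
  have "\<exists>T. open T \<and> P x = X \<inter> T" if x: "x \<in> K" for x
    using compact_opensE[of "P x" X] P[OF x] by metis
  then obtain T where T: "\<And>x. x \<in> K \<Longrightarrow> open (T x) \<and> P x = X \<inter> T x" by metis
  have "K \<subseteq> (\<Union>x\<in>K. T x)" using P T by blast
  then obtain D where D: "D \<subseteq> K" "finite D" "K \<subseteq> (\<Union>x\<in>D. T x)"
    using compactE_image[OF K, of K T] T by metis
  have "K \<subseteq> X" using KS S openin_imp_subset by blast
  have "K \<subseteq> (\<Union>x\<in>D. P x)"
  proof
    fix y assume y: "y \<in> K"
    then obtain x where "x \<in> D" "y \<in> T x" using D(3) by blast
    then show "y \<in> (\<Union>x\<in>D. P x)" using T[of x] D(1) y \<open>K \<subseteq> X\<close> by auto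
  qed
  moreover have "\<forall>x\<in>D. P x \<in> compact_opens X \<and> P x \<subseteq> S (f x)" using P D(1) by auto
  ultimately show ?thesis using D(2) by (intro exI[of _ D] exI[of _ f] exI[of _ P]) simp
qed

lemma compact_between:
  assumes K: "compact K" and KS: "K \<subseteq> S" and S: "openin (top_of_set X) S"
  obtains C where "C \<in> compact_opens X" "K \<subseteq> C" "C \<subseteq> S"
proof -
  have "K \<subseteq> (\<Union>i::nat. S)" using KS by simp
  from compact_cover[OF K this S]
  obtain D :: "'a set" and P where D: "finite D" "\<forall>x\<in>D. P x \<in> compact_opens X \<and> P x \<subseteq> S" "K \<subseteq> (\<Union>x\<in>D. P x)"
    by blast
  show thesis
  proof (rule that[of "\<Union>x\<in>D. P x"])
    show "(\<Union>x\<in>D. P x) \<in> compact_opens X" using D by (intro compact_opens_UN) auto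
    show "K \<subseteq> (\<Union>x\<in>D. P x)" by (fact D(3))
    show "(\<Union>x\<in>D. P x) \<subseteq> S" using D(2) by auto
  qed
qed

text \<open>On open sets both functions are the supremum over compact open subsets, since a compact open set
  fits between any compact set and any open set around it; outer regularity passes the equality on to
  \<open>B\<close>.\<close>

lemma regular_unique:
  assumes f: "regular X \<B> f" and g: "regular X \<B> g"
    and eq: "\<And>C. C \<in> compact_opens X \<Longrightarrow> f C = g C" and B: "B \<in> \<B>"
  shows "f B = g B"
proof -
  have *: "h W = (SUP C\<in>{C\<in>compact_opens X. C \<subseteq> W}. h C)"
    if W: "openin (top_of_set X) W" and h: "regular X \<B> h" for h W
  proof -
    have mono: "\<And>K C. compact K \<Longrightarrow> K \<subseteq> C \<Longrightarrow> C \<in> compact_opens X \<Longrightarrow> h K \<le> h C"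
      using h unfolding regular_def by blast
    have inner: "h W = (SUP K\<in>{K. compact K \<and> K \<subseteq> W}. h K)"
      using h W unfolding regular_def by blast
    show ?thesis unfolding inner
    proof (rule antisym)
      show "(SUP K\<in>{K. compact K \<and> K \<subseteq> W}. h K) \<le> (SUP C\<in>{C\<in>compact_opens X. C \<subseteq> W}. h C)"
      proof (rule SUP_least)
        fix K assume "K \<in> {K. compact K \<and> K \<subseteq> W}"
        then have K: "compact K" "K \<subseteq> W" by auto
        obtain C where C: "C \<in> compact_opens X" "K \<subseteq> C" "C \<subseteq> W" using compact_between[OF K W] .
        show "h K \<le> (SUP C\<in>{C\<in>compact_opens X. C \<subseteq> W}. h C)"
          using mono[OF K(1) C(2,1)] C by (intro SUP_upper2[of C]) auto
      qed
      show "(SUP C\<in>{C\<in>compact_opens X. C \<subseteq> W}. h C) \<le> (SUP K\<in>{K. compact K \<and> K \<subseteq> W}. h K)"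
        using compact_opensD(1) by (intro SUP_subset_mono) auto
    qed
  qed
  have "f W = g W" if "openin (top_of_set X) W" for W
    unfolding *[OF that f] *[OF that g] by (intro SUP_cong) (auto simp: eq)
  then have "(INF W\<in>{W. openin (top_of_set X) W \<and> B \<subseteq> W}. f W) = (INF W\<in>{W. openin (top_of_set X) W \<and> B \<subseteq> W}. g W)"
    by (intro INF_cong) auto
  moreover have "f B = (INF W\<in>{W. openin (top_of_set X) W \<and> B \<subseteq> W}. f W)"
    using f B unfolding regular_def by blast
  moreover have "g B = (INF W\<in>{W. openin (top_of_set X) W \<and> B \<subseteq> W}. g W)"
    using g B unfolding regular_def by blast
  ultimately show ?thesis by simp
qed

end

text \<open>The measure of an open set will be the supremum of the contents of its compact open subsets, and the
  measure of an arbitrary set the infimum over the open sets around it. The Borel sets need not be generated by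
  the compact open ones, so Caratheodory's theorem is applied to this outer measure rather than to
  an outer measure induced by countable covers with compact open sets.\<close>

locale zero_dimensional_content = zero_dimensional X for X :: "'a::t2_space set" +
  fixes m :: "'a set \<Rightarrow> real"
  assumes m_nonneg: "\<And>C. C \<in> compact_opens X \<Longrightarrow> 0 \<le> m C"
    and m_Un: "\<And>C D. C \<in> compact_opens X \<Longrightarrow> D \<in> compact_opens X \<Longrightarrow> C \<inter> D = {} \<Longrightarrow> m (C \<union> D) = m C + m D"
begin

lemma m_empty: "m {} = 0"
  using m_Un[OF compact_opens_ring(1) compact_opens_ring(1)] by simp

lemma m_mono:
  assumes "C \<in> compact_opens X" "D \<in> compact_opens X" "C \<subseteq> D"
  shows "m C \<le> m D"
proof -
  have DC: "D - C \<in> compact_opens X" using assms compact_opens_ring(4) by blast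
  have "m (C \<union> (D - C)) = m C + m (D - C)" by (rule m_Un[OF assms(1) DC]) auto
  moreover have "C \<union> (D - C) = D" using assms(3) by auto
  ultimately show ?thesis using m_nonneg[OF DC] by simp
qed

lemma m_Un_le:
  assumes "C \<in> compact_opens X" "D \<in> compact_opens X"
  shows "m (C \<union> D) \<le> m C + m D"
proof -
  have DC: "D - C \<in> compact_opens X" using assms compact_opens_ring(4) by blast
  have "m (C \<union> (D - C)) = m C + m (D - C)" by (rule m_Un[OF assms(1) DC]) auto
  moreover have "m (D - C) \<le> m D" using m_mono[OF DC assms(2)] by auto
  ultimately show ?thesis by simp
qed

lemma m_UN_le:
  assumes "finite I" "\<And>i. i \<in> I \<Longrightarrow> C i \<in> compact_opens X"
  shows "m (\<Union>i\<in>I. C i) \<le> (\<Sum>i\<in>I. m (C i))"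
  using assms
proof (induction I)
  case (insert i I)
  have "m (C i \<union> (\<Union>i\<in>I. C i)) \<le> m (C i) + m (\<Union>i\<in>I. C i)"
    using insert by (intro m_Un_le compact_opens_UN) auto
  then show ?case using insert by force
qed (simp add: m_empty)

definition inner_content :: "'a set \<Rightarrow> ennreal" where
  "inner_content S = (SUP C\<in>{C\<in>compact_opens X. C \<subseteq> S}. ennreal (m C))"

definition outer_content :: "'a set \<Rightarrow> ennreal" where
  "outer_content A = (INF S\<in>{S. openin (top_of_set X) S \<and> A \<subseteq> S}. inner_content S)"

lemma inner_content_upper: "C \<in> compact_opens X \<Longrightarrow> C \<subseteq> S \<Longrightarrow> ennreal (m C) \<le> inner_content S"
  unfolding inner_content_def by (intro SUP_upper) auto

lemma inner_content_mono: "S \<subseteq> T \<Longrightarrow> inner_content S \<le> inner_content T"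
  unfolding inner_content_def by (intro SUP_subset_mono) auto

lemma inner_content_compact_open: "C \<in> compact_opens X \<Longrightarrow> inner_content C = ennreal (m C)"
  unfolding inner_content_def
  by (intro antisym SUP_least SUP_upper) (auto intro!: ennreal_leI m_mono)

lemma outer_content_lower: "openin (top_of_set X) S \<Longrightarrow> A \<subseteq> S \<Longrightarrow> outer_content A \<le> inner_content S"
  unfolding outer_content_def by (intro INF_lower) auto

lemma outer_content_open: "openin (top_of_set X) S \<Longrightarrow> outer_content S = inner_content S"
  unfolding outer_content_def by (intro antisym INF_greatest INF_lower) (auto intro: inner_content_mono)

lemma outer_content_mono: "A \<subseteq> B \<Longrightarrow> outer_content A \<le> outer_content B"
  unfolding outer_content_def by (intro INF_superset_mono) auto

lemma outer_content_empty: "outer_content {} = 0"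
proof -
  have "inner_content {} = 0" using inner_content_compact_open[OF compact_opens_ring(1)] m_empty by simp
  then show ?thesis using outer_content_open[of "{}"] by simp
qed

text \<open>A compact open subset of the union is covered by finitely many compact open sets, each inside some \<open>T n\<close>;
  grouping them by \<open>n\<close> reduces the claim to finite subadditivity.\<close>

lemma inner_content_UN_le:
  fixes T :: "nat \<Rightarrow> 'a set"
  assumes T: "\<And>i. openin (top_of_set X) (T i)"
  shows "inner_content (\<Union>i. T i) \<le> (\<Sum>i. inner_content (T i))"
  unfolding inner_content_def[of "\<Union>i. T i"]
proof (rule SUP_least)
  fix C assume "C \<in> {C\<in>compact_opens X. C \<subseteq> (\<Union>i. T i)}"
  then have C: "C \<in> compact_opens X" "C \<subseteq> (\<Union>i. T i)" by auto
  obtain D :: "'a set" and f P where D: "finite D" "\<forall>x\<in>D. P x \<in> compact_opens X \<and> P x \<subseteq> T (f x)" "C \<subseteq> (\<Union>x\<in>D. P x)"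
    using compact_cover[OF compact_opensD(1)[OF C(1)] C(2) T] by blast
  define Q where "Q n = (\<Union>x\<in>{x\<in>D. f x = n}. P x)" for n
  have Q: "Q n \<in> compact_opens X" "Q n \<subseteq> T n" for n
    unfolding Q_def using D(1,2) by (auto intro!: compact_opens_UN)
  obtain N where N: "\<And>x. x \<in> D \<Longrightarrow> f x < N"
    using D(1) by (metis finite_imageI finite_nat_set_iff_bounded imageI)
  have "C \<subseteq> (\<Union>n<N. Q n)" using D(3) N by (force simp: Q_def)
  then have "m C \<le> m (\<Union>n<N. Q n)" using Q by (intro m_mono C compact_opens_UN) auto
  also have "\<dots> \<le> (\<Sum>n<N. m (Q n))" using Q by (intro m_UN_le) auto
  finally have "ennreal (m C) \<le> ennreal (\<Sum>n<N. m (Q n))" by (rule ennreal_leI)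
  also have "\<dots> = (\<Sum>n<N. ennreal (m (Q n)))" using Q(1) m_nonneg by (simp add: sum_ennreal)
  also have "\<dots> \<le> (\<Sum>n<N. inner_content (T n))" using Q by (intro sum_mono inner_content_upper) auto
  also have "\<dots> \<le> (\<Sum>n. inner_content (T n))" by (intro sum_le_suminf) auto
  finally show "ennreal (m C) \<le> (\<Sum>n. inner_content (T n))" .
qed

lemma outer_measure_space_outer_content: "outer_measure_space (Pow X) outer_content"
  unfolding outer_measure_space_def
proof (intro conjI)
  show "positive (Pow X) outer_content" by (simp add: positive_def outer_content_empty)
  show "increasing (Pow X) outer_content" by (simp add: increasing_def outer_content_mono)
  show "countably_subadditive (Pow X) outer_content"
    unfolding countably_subadditive_def
  proof (intro allI impI)
    fix A :: "nat \<Rightarrow> 'a set"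
    show "outer_content (\<Union>i. A i) \<le> (\<Sum>i. outer_content (A i))"
    proof (rule ennreal_le_epsilon)
      fix e :: real assume e: "0 < e" and fin: "(\<Sum>i. outer_content (A i)) < top"
      then have *: "outer_content (A n) < outer_content (A n) + e * (1/2)^Suc n" for n
        by (auto simp add: less_top dest!: ennreal_suminf_lessD)
      have "\<exists>S. openin (top_of_set X) S \<and> A n \<subseteq> S \<and> inner_content S \<le> outer_content (A n) + e * (1/2)^Suc n" for n
        using *[of n] unfolding outer_content_def[of "A n"] INF_less_iff
        by (metis (mono_tags, lifting) less_imp_le mem_Collect_eq)
      then obtain S where S: "\<And>n. openin (top_of_set X) (S n)" "\<And>n. A n \<subseteq> S n"
         "\<And>n. inner_content (S n) \<le> outer_content (A n) + e * (1/2)^Suc n" by metis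
      have "outer_content (\<Union>i. A i) \<le> inner_content (\<Union>i. S i)" using S by (intro outer_content_lower openin_Union) auto
      also have "\<dots> \<le> (\<Sum>i. inner_content (S i))" by (rule inner_content_UN_le[OF S(1)])
      also have "\<dots> \<le> (\<Sum>n. outer_content (A n) + e * (1/2) ^ Suc n)"
        by (intro suminf_le S(3)) auto
      also have "\<dots> = (\<Sum>n. outer_content (A n)) + (\<Sum>n. ennreal e * ennreal ((1/2) ^ Suc n))"
        using \<open>0 < e\<close> by (subst suminf_add[symmetric])
          (auto simp del: ennreal_suminf_cmult simp add: ennreal_mult[symmetric])
      also have "\<dots> = (\<Sum>n. outer_content (A n)) + e"
        unfolding ennreal_suminf_cmult
        by (subst suminf_ennreal_eq[OF zero_le_power power_half_series]) auto
      finally show "outer_content (\<Union>i. A i) \<le> (\<Sum>n. outer_content (A n)) + e" .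
    qed
  qed
qed

text \<open>To split \<open>A\<close> along an open set \<open>T\<close>, approximate \<open>S \<inter> T\<close> from inside by a compact open \<open>C\<close>, where \<open>S\<close> is an open
  set around \<open>A\<close>. Then \<open>S - C\<close> is open and contains \<open>A - T\<close>, and compact open subsets of \<open>S - C\<close> are
  disjoint from \<open>C\<close>.\<close>

lemma open_lambda_system:
  assumes T: "openin (top_of_set X) T"
  shows "T \<in> lambda_system X (Pow X) outer_content"
proof -
  interpret sigma_algebra X "Pow X" by (rule sigma_algebra_Pow)
  have TX: "T \<subseteq> X" using T openin_imp_subset by blast
  have "outer_content (A \<inter> T) + outer_content (A - T) = outer_content A" if A: "A \<subseteq> X" for A
  proof (rule antisym)
    show "outer_content (A \<inter> T) + outer_content (A - T) \<le> outer_content A"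
      unfolding outer_content_def[of A]
    proof (rule INF_greatest)
      fix S assume "S \<in> {S. openin (top_of_set X) S \<and> A \<subseteq> S}"
      then have S: "openin (top_of_set X) S" "A \<subseteq> S" by auto
      have "ennreal (m C) + outer_content (A - T) \<le> inner_content S" if C: "C \<in> compact_opens X" "C \<subseteq> S \<inter> T" for C
      proof -
        have "openin (top_of_set X) (S - C)"
          using S(1) compact_imp_closed[OF compact_opensD(1)[OF C(1)]]
          by (metis Diff_eq openin_Int_open open_Compl)
        then have "outer_content (A - T) \<le> inner_content (S - C)" using C(2) S(2) by (intro outer_content_lower) auto
        then have "ennreal (m C) + outer_content (A - T) \<le> ennreal (m C) + inner_content (S - C)" by (rule add_left_mono)
        also have "\<dots> = (SUP D\<in>{D\<in>compact_opens X. D \<subseteq> S - C}. ennreal (m C) + ennreal (m D))"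
          unfolding inner_content_def using compact_opens_ring(1)[of X] by (intro ennreal_SUP_add_right) blast
        also have "\<dots> \<le> inner_content S"
        proof (rule SUP_least)
          fix D assume "D \<in> {D\<in>compact_opens X. D \<subseteq> S - C}"
          then have D: "D \<in> compact_opens X" "D \<subseteq> S - C" by auto
          have "ennreal (m C) + ennreal (m D) = ennreal (m (C \<union> D))"
            using m_nonneg[OF C(1)] m_nonneg[OF D(1)] m_Un[OF C(1) D(1)] D(2) by (subst m_Un[OF C(1) D(1)]) auto
          also have "\<dots> \<le> inner_content S" using C D by (intro inner_content_upper compact_opens_ring) auto
          finally show "ennreal (m C) + ennreal (m D) \<le> inner_content S" .
        qed
        finally show ?thesis .
      qed
      then have "(SUP C\<in>{C\<in>compact_opens X. C \<subseteq> S \<inter> T}. ennreal (m C) + outer_content (A - T)) \<le> inner_content S"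
        by (intro SUP_least) auto
      moreover have "(SUP C\<in>{C\<in>compact_opens X. C \<subseteq> S \<inter> T}. ennreal (m C) + outer_content (A - T)) = inner_content (S \<inter> T) + outer_content (A - T)"
        unfolding inner_content_def using compact_opens_ring(1)[of X] by (intro ennreal_SUP_add_left) blast
      moreover have "outer_content (A \<inter> T) \<le> inner_content (S \<inter> T)" using S T by (intro outer_content_lower openin_Int) auto
      ultimately show "outer_content (A \<inter> T) + outer_content (A - T) \<le> inner_content S"
        by (metis add_right_mono order_trans)
    qed
    have "subadditive (Pow X) outer_content"
      using outer_measure_space_outer_content unfolding outer_measure_space_def
      by (auto intro: countably_subadditive_subadditive)
    then have "outer_content ((A \<inter> T) \<union> (A - T)) \<le> outer_content (A \<inter> T) + outer_content (A - T)"
      using A by (intro subadditiveD) auto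
    then show "outer_content A \<le> outer_content (A \<inter> T) + outer_content (A - T)" by (simp add: Int_Diff_Un)
  qed
  then show ?thesis using TX by (auto simp: lambda_system_eq)
qed

lemma borel_lambda_system: "sets (restrict_space borel X) \<subseteq> lambda_system X (Pow X) outer_content"
proof
  interpret P: sigma_algebra X "Pow X" by (rule sigma_algebra_Pow)
  have ms: "measure_space X (lambda_system X (Pow X) outer_content) outer_content"
    by (rule P.caratheodory_lemma[OF outer_measure_space_outer_content])
  then interpret L: sigma_algebra X "lambda_system X (Pow X) outer_content" by (simp add: measure_space_def)
  fix B assume "B \<in> sets (restrict_space borel X)"
  then obtain A where A: "A \<in> sets borel" "B = X \<inter> A" by (auto simp: sets_restrict_space)
  have "A \<in> sigma_sets UNIV {S. open S}" using A(1) by (simp add: borel_def)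
  then have "X \<inter> A \<in> lambda_system X (Pow X) outer_content"
  proof induction
    case (Basic a)
    then show ?case by (auto intro!: open_lambda_system)
  next
    case (Compl a)
    have "X \<inter> (UNIV - a) = X - X \<inter> a" by auto
    then show ?case using L.compl_sets[OF Compl.IH] by simp
  next
    case (Union a)
    have "X \<inter> (\<Union>i. a i) = (\<Union>i. X \<inter> a i)" by auto
    moreover have "(\<Union>i. X \<inter> a i) \<in> lambda_system X (Pow X) outer_content" using Union.IH by (intro L.countable_UN) auto
    ultimately show ?case by simp
  qed auto
  then show "B \<in> lambda_system X (Pow X) outer_content" using A(2) by simp
qed

lemma openin_sets:
  assumes "openin (top_of_set X) W"
  shows "W \<in> sets (restrict_space borel X)"
proof -
  obtain T where T: "open T" "W = X \<inter> T" using assms unfolding openin_open by metis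
  then show ?thesis unfolding sets_restrict_space by (intro image_eqI[of _ _ T]) auto
qed

theorem ex_regular_extension:
  obtains \<mu> where "space \<mu> = X" "sets \<mu> = sets (restrict_space borel X)"
    "\<And>C. C \<in> compact_opens X \<Longrightarrow> emeasure \<mu> C = ennreal (m C)"
    "\<And>B. B \<in> sets \<mu> \<Longrightarrow> emeasure \<mu> B = (INF W\<in>{W. openin (top_of_set X) W \<and> B \<subseteq> W}. emeasure \<mu> W)"
    "\<And>W. openin (top_of_set X) W \<Longrightarrow> emeasure \<mu> W = (SUP K\<in>{K. compact K \<and> K \<subseteq> W}. emeasure \<mu> K)"
proof -
  let ?\<B> = "sets (restrict_space borel X)"
  interpret P: sigma_algebra X "Pow X" by (rule sigma_algebra_Pow)
  have sa: "sigma_algebra X ?\<B>"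
    using sets.sigma_algebra_axioms[of "restrict_space borel X"] by (simp add: space_restrict_space)
  have ms: "measure_space X ?\<B> outer_content"
    using P.caratheodory_lemma[OF outer_measure_space_outer_content] sa borel_lambda_system by (rule measure_down)
  define \<mu> where "\<mu> = measure_of X ?\<B> outer_content"
  have sets: "sets \<mu> = ?\<B>" and space: "space \<mu> = X"
    using sa by (auto simp: \<mu>_def sigma_algebra.sets_measure_of_eq sigma_algebra.space_measure_of_eq)
  have em: "emeasure \<mu> B = outer_content B" if "B \<in> ?\<B>" for B
    unfolding \<mu>_def using ms that by (intro emeasure_measure_of_sigma) (auto simp: measure_space_def)
  have eo: "emeasure \<mu> W = inner_content W" if "openin (top_of_set X) W" for W
    using em[OF openin_sets[OF that]] outer_content_open[OF that] by simp
  show thesis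
  proof (rule that[OF space sets])
    show "emeasure \<mu> C = ennreal (m C)" if "C \<in> compact_opens X" for C
      using eo[OF compact_opensD(2)[OF that]] inner_content_compact_open[OF that] by simp
    show "emeasure \<mu> B = (INF W\<in>{W. openin (top_of_set X) W \<and> B \<subseteq> W}. emeasure \<mu> W)" if "B \<in> sets \<mu>" for B
      using em that sets eo by (auto simp: outer_content_def intro!: INF_cong)
    fix W assume W: "openin (top_of_set X) W"
    show "emeasure \<mu> W = (SUP K\<in>{K. compact K \<and> K \<subseteq> W}. emeasure \<mu> K)"
    proof (rule antisym)
      show "emeasure \<mu> W \<le> (SUP K\<in>{K. compact K \<and> K \<subseteq> W}. emeasure \<mu> K)"
        unfolding eo[OF W] inner_content_def
      proof (rule SUP_least)
        fix C assume "C \<in> {C\<in>compact_opens X. C \<subseteq> W}"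
        then have C: "C \<in> compact_opens X" "C \<subseteq> W" by auto
        have "ennreal (m C) = emeasure \<mu> C" using eo[OF compact_opensD(2)[OF C(1)]] inner_content_compact_open[OF C(1)] by simp
        also have "\<dots> \<le> (SUP K\<in>{K. compact K \<and> K \<subseteq> W}. emeasure \<mu> K)"
          using C compact_opensD(1)[OF C(1)] by (intro SUP_upper) auto
        finally show "ennreal (m C) \<le> (SUP K\<in>{K. compact K \<and> K \<subseteq> W}. emeasure \<mu> K)" .
      qed
      show "(SUP K\<in>{K. compact K \<and> K \<subseteq> W}. emeasure \<mu> K) \<le> emeasure \<mu> W"
        using openin_sets[OF W] sets by (intro SUP_least emeasure_mono) auto
    qed
  qed
qed

end

section \<open>Haar measure and the modular function\<close>

lemma ennreal_mult_INF:
  assumes c: "0 < (c::real)"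
  shows "ennreal c * (INF i\<in>I. f i) = (INF i\<in>I. ennreal c * f i)"
proof (rule antisym)
  show "ennreal c * (INF i\<in>I. f i) \<le> (INF i\<in>I. ennreal c * f i)"
    by (intro INF_greatest mult_left_mono INF_lower) auto
  have inv: "ennreal (1/c) * (ennreal c * y) = y" "ennreal c * (ennreal (1/c) * y) = y" for y
    using c by (simp_all add: mult.assoc[symmetric] ennreal_mult[symmetric])
  have "ennreal (1/c) * (INF i\<in>I. ennreal c * f i) \<le> (INF i\<in>I. f i)"
  proof (rule INF_greatest)
    fix i assume "i \<in> I"
    then have "ennreal (1/c) * (INF i\<in>I. ennreal c * f i) \<le> ennreal (1/c) * (ennreal c * f i)"
      by (intro mult_left_mono INF_lower) auto
    then show "ennreal (1/c) * (INF i\<in>I. ennreal c * f i) \<le> f i" using inv by simp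
  qed
  then have "ennreal c * (ennreal (1/c) * (INF i\<in>I. ennreal c * f i)) \<le> ennreal c * (INF i\<in>I. f i)"
    by (rule mult_left_mono) auto
  then show "(INF i\<in>I. ennreal c * f i) \<le> ennreal c * (INF i\<in>I. f i)" using inv by simp
qed

text \<open>Left translations and automorphisms are treated alike: both are homeomorphisms of the ambient group that map
  \<open>H\<close> onto itself.\<close>

definition homeo_onto :: "'a::topological_space set \<Rightarrow> ('a \<Rightarrow> 'a) \<Rightarrow> bool" where
  "homeo_onto H \<phi> \<longleftrightarrow> bij \<phi> \<and> continuous_on UNIV \<phi> \<and> continuous_on UNIV (inv \<phi>) \<and> \<phi> ` H = H"

lemma homeo_onto_inv:
  assumes "homeo_onto H \<phi>"
  shows "homeo_onto H (inv \<phi>)"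
proof -
  have b: "bij \<phi>" "\<phi> ` H = H" using assms by (auto simp: homeo_onto_def)
  have "inv \<phi> ` H = inv \<phi> ` (\<phi> ` H)" using b(2) by simp
  also have "\<dots> = H" using b(1) by (simp add: image_inv_f_f bij_is_inj)
  finally show ?thesis using assms b by (simp add: homeo_onto_def bij_imp_bij_inv inv_inv_eq)
qed

lemma homeo_onto_openin:
  assumes "homeo_onto H \<phi>" "openin (top_of_set H) W"
  shows "openin (top_of_set H) (\<phi> ` W)"
proof -
  obtain T where T: "open T" "W = H \<inter> T" using assms(2) unfolding openin_open by metis
  have b: "bij \<phi>" "continuous_on UNIV (inv \<phi>)" "\<phi> ` H = H" using assms(1) by (auto simp: homeo_onto_def)
  have "\<phi> ` W = H \<inter> \<phi> ` T" using T(2) b by (metis bij_is_inj image_Int)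
  moreover have "\<phi> ` T = inv \<phi> -` T" using b(1) by (simp add: bij_vimage_eq_inv_image bij_imp_bij_inv inv_inv_eq)
  moreover have "open (inv \<phi> -` T)" using b(2) T(1) by (simp add: open_vimage)
  ultimately show ?thesis by (metis openin_open_Int)
qed

lemma homeo_onto_compact: "homeo_onto H \<phi> \<Longrightarrow> compact K \<Longrightarrow> compact (\<phi> ` K)"
  by (meson homeo_onto_def compact_continuous_image continuous_on_subset subset_UNIV)

lemma homeo_onto_compact_opens: "homeo_onto H \<phi> \<Longrightarrow> C \<in> compact_opens H \<Longrightarrow> \<phi> ` C \<in> compact_opens H"
  by (simp add: compact_opens_def homeo_onto_openin homeo_onto_compact)

lemma homeo_onto_sets:
  assumes "homeo_onto H \<phi>" "B \<in> sets (restrict_space borel H)"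
  shows "\<phi> ` B \<in> sets (restrict_space borel H)"
proof -
  obtain A where A: "A \<in> sets borel" "B = H \<inter> A" using assms(2) by (auto simp: sets_restrict_space)
  have b: "bij \<phi>" "continuous_on UNIV (inv \<phi>)" "\<phi> ` H = H" using assms(1) by (auto simp: homeo_onto_def)
  have "\<phi> ` B = H \<inter> \<phi> ` A" using A(2) b by (metis bij_is_inj image_Int)
  moreover have "\<phi> ` A = inv \<phi> -` A" using b(1) by (simp add: bij_vimage_eq_inv_image bij_imp_bij_inv inv_inv_eq)
  moreover have "inv \<phi> -` A \<inter> space borel \<in> sets borel"
    using borel_measurable_continuous_onI[OF b(2)] A(1) by (rule measurable_sets)
  ultimately show ?thesis by (auto simp: sets_restrict_space)
qed

lemma regular_image:
  assumes reg: "regular H (sets (restrict_space borel H)) f" and \<phi>: "homeo_onto H \<phi>"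
  shows "regular H (sets (restrict_space borel H)) (\<lambda>B. f (\<phi> ` B))"
proof -
  have b: "bij \<phi>" using \<phi> by (auto simp: homeo_onto_def)
  have inj: "\<phi> ` A \<subseteq> \<phi> ` A' \<longleftrightarrow> A \<subseteq> A'" for A A' using b by (simp add: inj_image_subset_iff bij_is_inj)
  have ff: "\<phi> ` (inv \<phi> ` A) = A" for A using b by (simp add: image_f_inv_f bij_is_surj)
  have 1: "{W. openin (top_of_set H) W \<and> \<phi> ` B \<subseteq> W} = (`) \<phi> ` {W. openin (top_of_set H) W \<and> B \<subseteq> W}" (is "?L = ?R") for B
  proof
    show "?R \<subseteq> ?L" using homeo_onto_openin[OF \<phi>] by auto
    show "?L \<subseteq> ?R"
    proof
      fix W assume W: "W \<in> ?L"
      then have "openin (top_of_set H) (inv \<phi> ` W)" using homeo_onto_openin[OF homeo_onto_inv[OF \<phi>]] by auto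
      moreover have "B \<subseteq> inv \<phi> ` W" using inj[of B "inv \<phi> ` W"] ff[of W] W by auto
      ultimately show "W \<in> ?R" using ff[of W] by (intro image_eqI[of _ _ "inv \<phi> ` W"]) auto
    qed
  qed
  have 2: "{K. compact K \<and> K \<subseteq> \<phi> ` W} = (`) \<phi> ` {K. compact K \<and> K \<subseteq> W}" (is "?L = ?R") for W
  proof
    show "?R \<subseteq> ?L" using homeo_onto_compact[OF \<phi>] by auto
    show "?L \<subseteq> ?R"
    proof
      fix K assume K: "K \<in> ?L"
      then have "compact (inv \<phi> ` K)" using homeo_onto_compact[OF homeo_onto_inv[OF \<phi>]] by auto
      moreover have "inv \<phi> ` K \<subseteq> W" using inj[of "inv \<phi> ` K" W] ff[of K] K by auto
      ultimately show "K \<in> ?R" using ff[of K] by (intro image_eqI[of _ _ "inv \<phi> ` K"]) auto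
    qed
  qed
  show ?thesis unfolding regular_def
  proof (intro conjI ballI allI impI)
    fix B assume "B \<in> sets (restrict_space borel H)"
    from homeo_onto_sets[OF \<phi> this]
    have "f (\<phi> ` B) = (INF W\<in>{W. openin (top_of_set H) W \<and> \<phi> ` B \<subseteq> W}. f W)"
      using reg unfolding regular_def by blast
    then show "f (\<phi> ` B) = (INF W\<in>{W. openin (top_of_set H) W \<and> B \<subseteq> W}. f (\<phi> ` W))"
      unfolding 1 by (simp add: image_image)
  next
    fix W assume "openin (top_of_set H) W"
    from homeo_onto_openin[OF \<phi> this]
    have "f (\<phi> ` W) = (SUP K\<in>{K. compact K \<and> K \<subseteq> \<phi> ` W}. f K)"
      using reg unfolding regular_def by blast
    then show "f (\<phi> ` W) = (SUP K\<in>{K. compact K \<and> K \<subseteq> W}. f (\<phi> ` K))"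
      unfolding 2 by (simp add: image_image)
  next
    fix K C assume "compact K" "K \<subseteq> C" "C \<in> compact_opens H"
    then show "f (\<phi> ` K) \<le> f (\<phi> ` C)"
      using reg homeo_onto_compact[OF \<phi>] homeo_onto_compact_opens[OF \<phi>] unfolding regular_def
      by (meson image_mono)
  qed
qed

lemma regular_scale:
  assumes reg: "regular H \<B> f" and c: "0 < (c::real)"
  shows "regular H \<B> (\<lambda>B. ennreal c * f B)"
  unfolding regular_def
proof (intro conjI ballI allI impI)
  fix B assume "B \<in> \<B>"
  then have "f B = (INF W\<in>{W. openin (top_of_set H) W \<and> B \<subseteq> W}. f W)" using reg unfolding regular_def by blast
  then show "ennreal c * f B = (INF W\<in>{W. openin (top_of_set H) W \<and> B \<subseteq> W}. ennreal c * f W)"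
    using ennreal_mult_INF[OF c, of f "{W. openin (top_of_set H) W \<and> B \<subseteq> W}"] by simp
next
  fix W assume "openin (top_of_set H) W"
  then have "f W = (SUP K\<in>{K. compact K \<and> K \<subseteq> W}. f K)" using reg unfolding regular_def by blast
  then show "ennreal c * f W = (SUP K\<in>{K. compact K \<and> K \<subseteq> W}. ennreal c * f K)"
    using SUP_mult_left_ennreal[of "ennreal c" f "{K. compact K \<and> K \<subseteq> W}"] by simp
next
  fix K C assume "compact K" "K \<subseteq> C" "C \<in> compact_opens H"
  then have "f K \<le> f C" using reg unfolding regular_def by blast
  then show "ennreal c * f K \<le> ennreal c * f C" by (rule mult_left_mono) simp
qed

lemma left_HaarD:
  assumes "left_Haar_measure H \<mu>"
  shows "sets \<mu> = sets (restrict_space borel H)" "emeasure \<mu> H \<noteq> 0"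
    "x \<in> H \<Longrightarrow> B \<in> sets \<mu> \<Longrightarrow> emeasure \<mu> ((+) x ` B) = emeasure \<mu> B"
    "K \<subseteq> H \<Longrightarrow> compact K \<Longrightarrow> emeasure \<mu> K < \<infinity>"
  using assms unfolding left_Haar_measure_def by (elim conjE; blast)+

context tdlc_group begin

lemma zero_dimensional: "zero_dimensional H"
proof
  fix S x assume S: "openin (top_of_set H) S" "x \<in> S"
  have x: "x \<in> H" using S openin_imp_subset by blast
  have "openin (top_of_set H) ((+) (- x) ` S)"
    using openin_translate[OF H is_subgroupD(3)[OF H x] S(1)] .
  moreover have "0 \<in> (+) (- x) ` S" using S(2) by (simp add: mem_translate)
  ultimately obtain V where V: "is_subgroup V \<and> V \<in> compact_opens H \<and> V \<subseteq> E \<and> V \<subseteq> (+) (- x) ` S"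
    using base by metis
  have "(+) x ` V \<subseteq> S"
  proof
    fix y assume "y \<in> (+) x ` V"
    then have "- x + y \<in> (+) (- x) ` S" using V mem_translate by blast
    then show "y \<in> S" by (simp add: mem_translate)
  qed
  moreover have "x \<in> (+) x ` V" using V is_subgroupD(1)[of V] by (simp add: mem_translate)
  ultimately show "\<exists>C\<in>compact_opens H. x \<in> C \<and> C \<subseteq> S"
    using translate_compact_opens[of V x] V x by blast
qed

text \<open>Uniqueness of Haar measure. It is stated for set functions on compact open sets because it will be applied
  both to a Haar measure \<open>\<mu>\<close> and to its pullback \<open>\<lambda>C. emeasure \<mu> (\<alpha> ` C)\<close>. If \<open>C\<close> is a union of cosets of \<open>V\<close>,
  then \<open>f C\<close> and \<open>f E\<close> are both multiples of \<open>f V\<close>, by the numbers of cosets.\<close>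

lemma content_unique:
  fixes f :: "'a set \<Rightarrow> ennreal"
  assumes empty: "f {} = 0"
    and add: "\<And>C D. C \<in> compact_opens H \<Longrightarrow> D \<in> compact_opens H \<Longrightarrow> C \<inter> D = {} \<Longrightarrow> f (C \<union> D) = f C + f D"
    and inv: "\<And>C x. C \<in> compact_opens H \<Longrightarrow> x \<in> H \<Longrightarrow> f ((+) x ` C) = f C"
    and C: "C \<in> compact_opens H"
  shows "f C = ennreal (content C) * f E"
proof -
  obtain V where V: "V \<in> open_subgroups" "stable V C" "content C = real (num_cosets V C) / real (num_cosets V E)"
    using eventually_content[OF C] small_not_bot by (metis (mono_tags, lifting) eventually_happens')
  have Vs: "is_subgroup V" by (rule open_subgroupsD(1)[OF V(1)])
  have *: "f D = of_nat (num_cosets V D) * f V" if D: "compact D" "D \<subseteq> H" "stable V D" for D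
  proof -
    define Y where "Y = (\<lambda>x. (+) x ` V) ` D"
    have fin: "finite Y" unfolding Y_def by (rule finite_cosets[OF D(1,2) V(1)])
    have "(\<Union>F \<in> compact_opens H) \<and> f (\<Union>F) = of_nat (card F) * f V" if "finite F" "F \<subseteq> Y" for F
      using that
    proof (induction F)
      case empty
      then show ?case using assms(1) compact_opens_ring(1) by auto
    next
      case (insert A F)
      obtain a where a: "a \<in> D" "A = (+) a ` V" using insert.prems Y_def by blast
      have A: "A \<in> compact_opens H" "f A = f V"
        using a D(2) translate_compact_opens[OF open_subgroupsD(2)[OF V(1)]] inv[OF open_subgroupsD(2)[OF V(1)]] by auto
      have "A \<inter> B = {}" if B: "B \<in> F" for B
      proof (rule equals0I)
        fix z assume z: "z \<in> A \<inter> B"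
        obtain b where b: "B = (+) b ` V" using B insert.prems Y_def by blast
        have "(+) a ` V = (+) z ` V" using coset_eq_iff[OF Vs] z a(2) mem_translate by blast
        moreover have "(+) b ` V = (+) z ` V" using coset_eq_iff[OF Vs] z b mem_translate by blast
        ultimately have "A = B" using a b by simp
        then show False using insert.hyps B by blast
      qed
      then have "A \<inter> \<Union>F = {}" by blast
      then have "f (A \<union> \<Union>F) = f A + f (\<Union>F)" using insert A by (intro add) auto
      moreover have "f (\<Union>F) = of_nat (card F) * f V" using insert by blast
      ultimately have "f (\<Union>(insert A F)) = of_nat (card (insert A F)) * f V"
        using A(2) insert.hyps by (simp add: distrib_right)
      moreover have "\<Union>(insert A F) \<in> compact_opens H"
        using compact_opens_ring(2)[OF A(1)] insert by simp
      ultimately show ?case by blast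
    qed
    then have "f (\<Union>Y) = of_nat (card Y) * f V" using fin by blast
    moreover have "\<Union>Y = D"
      using is_subgroupD(1)[OF Vs] D(3) by (force simp: Y_def mem_translate stable_def)
    ultimately show ?thesis by (simp add: num_cosets_def Y_def)
  qed
  have "E \<noteq> {}" using is_subgroupD(1)[OF E(1)] by blast
  then have pos: "num_cosets V E > 0" using num_cosets_pos[OF V(1)] compact_opensD[OF E(2)] by simp
  have "f C = of_nat (num_cosets V C) * f V" using * V(2) compact_opensD[OF C] by blast
  moreover have "f E = of_nat (num_cosets V E) * f V"
    using * stable_subgroup[OF E(1) open_subgroupsD(3)[OF V(1)]] compact_opensD[OF E(2)] by blast
  moreover have "ennreal (content C) * of_nat (num_cosets V E) = of_nat (num_cosets V C)"
    using pos V(3) by (simp add: ennreal_of_nat_eq_real_of_nat ennreal_mult[symmetric])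
  ultimately show ?thesis by (simp add: mult.assoc[symmetric])
qed

lemma compact_opens_sets:
  assumes "C \<in> compact_opens H"
  shows "C \<in> sets (restrict_space borel H)"
proof -
  obtain T where T: "open T" "C = H \<inter> T" using compact_opensE[OF assms] .
  then show ?thesis unfolding sets_restrict_space by (intro image_eqI[of _ _ T]) auto
qed

lemma Haar_regular:
  assumes "left_Haar_measure H \<mu>"
  shows "regular H (sets (restrict_space borel H)) (emeasure \<mu>)"
proof -
  have "emeasure \<mu> K \<le> emeasure \<mu> C" if "K \<subseteq> C" "C \<in> compact_opens H" for K C
  proof -
    show ?thesis using assms that(1) compact_opens_sets[OF that(2)] by (intro emeasure_mono) (auto simp: left_Haar_measure_def)
  qed
  then show ?thesis using assms by (auto simp: left_Haar_measure_def regular_def)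
qed

lemma homeo_translate: "x \<in> H \<Longrightarrow> homeo_onto H ((+) x)"
proof -
  assume x: "x \<in> H"
  have 1: "(+) x \<circ> (+) (- x) = id" "(+) (- x) \<circ> (+) x = id" by (rule ext, simp)+
  have inv: "inv ((+) x) = (+) (- x)" using 1 by (rule inv_unique_comp)
  have "bij ((+) x)" using 1(2,1) by (rule o_bij)
  then show ?thesis using translate_subgroup[OF H x] unfolding homeo_onto_def inv
    by (intro conjI continuous_on_translate)
qed

theorem ex_Haar: "\<exists>\<mu>. left_Haar_measure H \<mu>"
proof -
  interpret Z: zero_dimensional H by (rule zero_dimensional)
  interpret R: zero_dimensional_content H content
    by unfold_locales (fact content_nonneg, fact content_Un)
  show ?thesis
  proof (rule R.ex_regular_extension)
    fix \<mu> assume \<mu>: "space \<mu> = H" "sets \<mu> = sets (restrict_space borel H)"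
      "\<And>C. C \<in> compact_opens H \<Longrightarrow> emeasure \<mu> C = ennreal (content C)"
      "\<And>B. B \<in> sets \<mu> \<Longrightarrow> emeasure \<mu> B = (INF W\<in>{W. openin (top_of_set H) W \<and> B \<subseteq> W}. emeasure \<mu> W)"
      "\<And>W. openin (top_of_set H) W \<Longrightarrow> emeasure \<mu> W = (SUP K\<in>{K. compact K \<and> K \<subseteq> W}. emeasure \<mu> K)"
    have mono: "emeasure \<mu> K \<le> emeasure \<mu> C" if "K \<subseteq> C" "C \<in> compact_opens H" for K C
      using compact_opens_sets[OF that(2)] that(1) \<mu>(2) by (intro emeasure_mono) auto
    have reg: "regular H (sets (restrict_space borel H)) (emeasure \<mu>)"
      using \<mu> mono by (auto simp: regular_def)
    have "emeasure \<mu> ((+) x ` B) = emeasure \<mu> B" if "x \<in> H" "B \<in> sets \<mu>" for x B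
    proof (rule Z.regular_unique[OF regular_image[OF reg homeo_translate[OF that(1)]] reg])
      show "B \<in> sets (restrict_space borel H)" using that \<mu>(2) by simp
      fix C assume C: "C \<in> compact_opens H"
      show "emeasure \<mu> ((+) x ` C) = emeasure \<mu> C"
        using \<mu>(3)[OF C] \<mu>(3)[OF translate_compact_opens[OF C that(1)]] content_translate[OF C that(1)] by simp
    qed
    moreover have "emeasure \<mu> H \<noteq> 0"
    proof -
      have "emeasure \<mu> E = 1" using \<mu>(3)[OF E(2)] content_E by simp
      moreover have "emeasure \<mu> E \<le> emeasure \<mu> H"
        using compact_opensD(3)[OF E(2)] \<mu>(1) by (metis emeasure_space)
      ultimately show ?thesis by auto
    qed
    moreover have "emeasure \<mu> K < \<infinity>" if K: "K \<subseteq> H" "compact K" for K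
    proof -
      have HH: "openin (top_of_set H) H" by simp
      obtain C where C: "C \<in> compact_opens H" "K \<subseteq> C" using Z.compact_between[OF K(2,1) HH] by metis
      then have "emeasure \<mu> K \<le> ennreal (content C)" using mono[OF C(2,1)] \<mu>(3) by simp
      then show ?thesis by (simp add: le_less_trans)
    qed
    ultimately have "left_Haar_measure H \<mu>" unfolding left_Haar_measure_def using \<mu> by auto
    then show ?thesis by blast
  qed
qed

lemma Haar_content:
  assumes \<mu>: "left_Haar_measure H \<mu>" and C: "C \<in> compact_opens H"
  shows "emeasure \<mu> C = ennreal (content C) * emeasure \<mu> E"
proof (rule content_unique[OF _ _ _ C])
  have s: "sets \<mu> = sets (restrict_space borel H)" using left_HaarD(1)[OF \<mu>] .
  show "emeasure \<mu> (C \<union> D) = emeasure \<mu> C + emeasure \<mu> D"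
    if "C \<in> compact_opens H" "D \<in> compact_opens H" "C \<inter> D = {}" for C D
    using that s compact_opens_sets by (intro plus_emeasure[symmetric]) auto
  show "emeasure \<mu> ((+) x ` C) = emeasure \<mu> C" if "C \<in> compact_opens H" "x \<in> H" for C x
    using left_HaarD(3)[OF \<mu> that(2)] compact_opens_sets[OF that(1)] s by simp
qed simp

lemma Haar_compact_open_pos_finite:
  assumes \<mu>: "left_Haar_measure H \<mu>" and C: "C \<in> compact_opens H"
  shows "C \<noteq> {} \<Longrightarrow> emeasure \<mu> C > 0" "emeasure \<mu> C < \<infinity>"
proof -
  interpret Z: zero_dimensional H by (rule zero_dimensional)
  show "emeasure \<mu> C < \<infinity>" 
    by (rule left_HaarD(4)[OF \<mu> compact_opensD(3)[OF C] compact_opensD(1)[OF C]])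
  assume ne: "C \<noteq> {}"
  have "emeasure \<mu> E \<noteq> 0"
  proof
    assume 0: "emeasure \<mu> E = 0"
    have "emeasure \<mu> K = 0" if K: "compact K" "K \<subseteq> H" for K
    proof -
      have HH: "openin (top_of_set H) H" by simp
      obtain D where D: "D \<in> compact_opens H" "K \<subseteq> D" using Z.compact_between[OF K HH] by metis
      then have "emeasure \<mu> K \<le> emeasure \<mu> D" using Haar_regular[OF \<mu>] K unfolding regular_def by blast
      also have "\<dots> = 0" using Haar_content[OF \<mu> D(1)] 0 by simp
      finally show ?thesis by simp
    qed
    then have "(SUP K\<in>{K. compact K \<and> K \<subseteq> H}. emeasure \<mu> K) \<le> 0"
      by (intro SUP_least) simp
    moreover have "emeasure \<mu> H = (SUP K\<in>{K. compact K \<and> K \<subseteq> H}. emeasure \<mu> K)"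
      using Haar_regular[OF \<mu>] unfolding regular_def by auto
    ultimately have "emeasure \<mu> H \<le> 0" by (rule ord_eq_le_trans[rotated])
    then have "emeasure \<mu> H = 0" by simp
    then show False using left_HaarD(2)[OF \<mu>] by simp
  qed
  then show "emeasure \<mu> C > 0" using Haar_content[OF \<mu> C] content_pos[OF C ne]
    by (simp add: ennreal_zero_less_mult_iff zero_less_iff_neq_zero)
qed

text \<open>The definite description that defines \<^const>\<open>modular\<close> is meaningful: the factor \<open>content (\<alpha> ` E)\<close> works for
  all Haar measures, by uniqueness, and it is the only one, since a Haar measure with \<open>0 < \<mu> E < \<infinity>\<close> exists.\<close>

theorem modular_eq:
  assumes \<alpha>: "\<alpha> \<in> Aut" "\<alpha> ` H = H"
  shows "modular H \<alpha> = content (\<alpha> ` E)" "0 < modular H \<alpha>"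
    "left_Haar_measure H \<mu> \<Longrightarrow> B \<in> sets \<mu> \<Longrightarrow> emeasure \<mu> (\<alpha> ` B) = ennreal (modular H \<alpha>) * emeasure \<mu> B"
proof -
  interpret Z: zero_dimensional H by (rule zero_dimensional)
  have h: "homeo_onto H \<alpha>" using \<alpha> by (auto simp: homeo_onto_def Aut_def)
  have hom: "\<alpha> (x + y) = \<alpha> x + \<alpha> y" for x y using \<alpha>(1) by (auto simp: Aut_def)
  have inj: "inj \<alpha>" using \<alpha>(1) by (auto simp: Aut_def bij_is_inj)
  define c where "c = content (\<alpha> ` E)"
  have \<alpha>E: "\<alpha> ` E \<in> compact_opens H" by (rule homeo_onto_compact_opens[OF h E(2)])
  have c: "0 < c" unfolding c_def using is_subgroupD(1)[OF E(1)] by (intro content_pos[OF \<alpha>E]) auto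
  have main: "emeasure \<mu> (\<alpha> ` B) = ennreal c * emeasure \<mu> B"
    if \<mu>: "left_Haar_measure H \<mu>" and B: "B \<in> sets \<mu>" for \<mu> B
  proof (rule Z.regular_unique[OF regular_image[OF Haar_regular[OF \<mu>] h] regular_scale[OF Haar_regular[OF \<mu>] c]])
    have s: "sets \<mu> = sets (restrict_space borel H)" using left_HaarD(1)[OF \<mu>] .
    then show "B \<in> sets (restrict_space borel H)" using B by simp
    fix C assume C: "C \<in> compact_opens H"
    have "emeasure \<mu> (\<alpha> ` C) = ennreal (content C) * emeasure \<mu> (\<alpha> ` E)"
    proof (rule content_unique[of "\<lambda>C. emeasure \<mu> (\<alpha> ` C)", OF _ _ _ C])
      show "emeasure \<mu> (\<alpha> ` (C \<union> D)) = emeasure \<mu> (\<alpha> ` C) + emeasure \<mu> (\<alpha> ` D)"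
        if CD: "C \<in> compact_opens H" "D \<in> compact_opens H" "C \<inter> D = {}" for C D
      proof -
        have "\<alpha> ` C \<inter> \<alpha> ` D = {}" using CD(3) inj by (metis image_Int image_empty)
        then show ?thesis unfolding image_Un
          using CD s compact_opens_sets homeo_onto_compact_opens[OF h]
          by (intro plus_emeasure[symmetric]) auto
      qed
      show "emeasure \<mu> (\<alpha> ` ((+) x ` C)) = emeasure \<mu> (\<alpha> ` C)" if Cx: "C \<in> compact_opens H" "x \<in> H" for C x
      proof -
        have "\<alpha> ` ((+) x ` C) = (+) (\<alpha> x) ` (\<alpha> ` C)" by (simp add: image_image hom)
        moreover have "\<alpha> x \<in> H" using Cx(2) \<alpha>(2) by blast
        ultimately show ?thesis
          using left_HaarD(3)[OF \<mu>] s compact_opens_sets[OF homeo_onto_compact_opens[OF h Cx(1)]]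
          by simp
      qed
    qed simp
    also have "\<dots> = ennreal c * emeasure \<mu> C"
      using Haar_content[OF \<mu> \<alpha>E] Haar_content[OF \<mu> C] by (simp add: c_def mult.left_commute)
    finally show "emeasure \<mu> (\<alpha> ` C) = ennreal c * emeasure \<mu> C" .
  qed
  have "modular H \<alpha> = c"
    unfolding modular_def
  proof (rule the_equality)
    show "0 < c \<and> (\<forall>\<mu>. left_Haar_measure H \<mu> \<longrightarrow> (\<forall>B\<in>sets \<mu>. emeasure \<mu> (\<alpha> ` B) = ennreal c * emeasure \<mu> B))"
      using c main by blast
    fix d assume d: "0 < d \<and> (\<forall>\<mu>. left_Haar_measure H \<mu> \<longrightarrow> (\<forall>B\<in>sets \<mu>. emeasure \<mu> (\<alpha> ` B) = ennreal d * emeasure \<mu> B))"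
    obtain \<mu> where \<mu>: "left_Haar_measure H \<mu>" using ex_Haar by blast
    have Es: "E \<in> sets \<mu>" using compact_opens_sets[OF E(2)] left_HaarD(1)[OF \<mu>] by simp
    have "ennreal c * emeasure \<mu> E = ennreal d * emeasure \<mu> E" using main[OF \<mu> Es] d \<mu> Es by metis
    moreover have "emeasure \<mu> E > 0" "emeasure \<mu> E < \<infinity>"
      using Haar_compact_open_pos_finite[OF \<mu> E(2)] is_subgroupD(1)[OF E(1)] by auto
    ultimately have "ennreal c = ennreal d" by (metis ennreal_mult_cancel_left mult.commute less_irrefl infinity_ennreal_def)
    then show "d = c" using c d by (simp add: ennreal_inj)
  qed
  then show "modular H \<alpha> = content (\<alpha> ` E)" "0 < modular H \<alpha>"
    "left_Haar_measure H \<mu> \<Longrightarrow> B \<in> sets \<mu> \<Longrightarrow> emeasure \<mu> (\<alpha> ` B) = ennreal (modular H \<alpha>) * emeasure \<mu> B"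
    using c main by (auto simp: c_def)
qed

end

section \<open>Bounded orbits and tidy subgroups\<close>

lemma tdlc_group_closed_subgroup:
  fixes U H :: "'a::{topological_group_add,t2_space} set"
  assumes td: "totally_disconnected (UNIV::'a set)" and U: "compact_open_subgroup U"
    and H: "is_subgroup H" "closed H"
  shows "tdlc_group H (U \<inter> H)"
proof
  have U': "is_subgroup U" "compact U" "open U" using U by (auto simp: compact_open_subgroup_def)
  have inter: "is_subgroup (V \<inter> H) \<and> V \<inter> H \<in> compact_opens H" if "compact_open_subgroup V" for V
    using that H by (auto simp: compact_open_subgroup_def compact_opens_def is_subgroup_def Int_commute
        intro: compact_Int_closed openin_open_Int)
  show "is_subgroup (U \<inter> H)" "U \<inter> H \<in> compact_opens H" using inter[OF U] by auto
  show "\<exists>V. is_subgroup V \<and> V \<in> compact_opens H \<and> V \<subseteq> U \<inter> H \<and> V \<subseteq> S"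
    if S: "openin (top_of_set H) S" "0 \<in> S" for S
  proof -
    obtain T where T: "open T" "S = H \<inter> T" using S(1) unfolding openin_open by metis
    obtain V where V: "compact_open_subgroup V" "V \<subseteq> U" "V \<subseteq> T"
      using van_Dantzig[OF td U T(1)] S(2) T(2) by auto
    then show ?thesis using inter[OF V(1)] T(2) by (intro exI[of _ "V \<inter> H"]) auto
  qed
qed (fact H(1))

lemma AutD:
  assumes "\<alpha> \<in> Aut"
  shows "bij \<alpha>" "\<alpha> (x + y) = \<alpha> x + \<alpha> y" "continuous_on S \<alpha>" "inj \<alpha>"
  using assms by (auto simp: Aut_def bij_is_inj intro: continuous_on_subset)

lemma Aut_zero: "\<alpha> \<in> Aut \<Longrightarrow> \<alpha> 0 = 0"
  using AutD(2)[of \<alpha> 0 0] by (metis add.right_neutral add_left_cancel)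

lemma Aut_minus: "\<alpha> \<in> Aut \<Longrightarrow> \<alpha> (- x) = - \<alpha> x"
  using AutD(2)[of \<alpha> "- x" x] Aut_zero[of \<alpha>] by (simp add: eq_neg_iff_add_eq_0)

lemma Aut_subgroup:
  assumes "\<alpha> \<in> Aut" "is_subgroup S"
  shows "is_subgroup (\<alpha> ` S)"
  unfolding is_subgroup_def
proof (intro conjI ballI)
  show "0 \<in> \<alpha> ` S" using Aut_zero[OF assms(1)] is_subgroupD(1)[OF assms(2)] by force
  fix x assume "x \<in> \<alpha> ` S"
  then obtain a where a: "a \<in> S" "x = \<alpha> a" by blast
  show "- x \<in> \<alpha> ` S" using a is_subgroupD(3)[OF assms(2) a(1)] Aut_minus[OF assms(1), of a] by (intro image_eqI[of _ _ "- a"]) auto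
  fix y assume "y \<in> \<alpha> ` S"
  then obtain b where b: "b \<in> S" "y = \<alpha> b" by blast
  show "x + y \<in> \<alpha> ` S" using a b is_subgroupD(2)[OF assms(2) a(1) b(1)] AutD(2)[OF assms(1)]
    by (intro image_eqI[of _ _ "a + b"]) auto
qed

lemma bij_funpow_inv:
  assumes "bij \<alpha>"
  shows "(inv \<alpha> ^^ n) ((\<alpha> ^^ n) x) = x" "(\<alpha> ^^ n) ((inv \<alpha> ^^ n) x) = x"
proof -
  show "(inv \<alpha> ^^ n) ((\<alpha> ^^ n) x) = x" for x
  proof (induction n arbitrary: x)
    case (Suc n)
    have "(inv \<alpha> ^^ Suc n) ((\<alpha> ^^ Suc n) x) = inv \<alpha> ((inv \<alpha> ^^ n) ((\<alpha> ^^ n) (\<alpha> x)))"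
      by (simp add: funpow_swap1)
    then show ?case using Suc assms by (simp add: bij_is_inj)
  qed simp
  show "(\<alpha> ^^ n) ((inv \<alpha> ^^ n) x) = x" for x
  proof (induction n arbitrary: x)
    case (Suc n)
    have "(\<alpha> ^^ Suc n) ((inv \<alpha> ^^ Suc n) x) = \<alpha> ((\<alpha> ^^ n) ((inv \<alpha> ^^ n) (inv \<alpha> x)))"
      by (simp add: funpow_swap1)
    then show ?case using Suc assms by (simp add: bij_is_surj surj_f_inv_f)
  qed simp
qed

lemma mem_funpow_image:
  fixes \<alpha> :: "'a \<Rightarrow> 'a"
  assumes "bij \<alpha>"
  shows "y \<in> (\<alpha> ^^ n) ` S \<longleftrightarrow> (inv \<alpha> ^^ n) y \<in> S" "y \<in> (inv \<alpha> ^^ n) ` S \<longleftrightarrow> (\<alpha> ^^ n) y \<in> S"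
proof -
  have *: "y \<in> f ` S \<longleftrightarrow> g y \<in> S" if "\<And>x. g (f x) = x" "\<And>x. f (g x) = x" for f g :: "'a \<Rightarrow> 'a"
    using that by (metis image_iff)
  show "y \<in> (\<alpha> ^^ n) ` S \<longleftrightarrow> (inv \<alpha> ^^ n) y \<in> S" "y \<in> (inv \<alpha> ^^ n) ` S \<longleftrightarrow> (\<alpha> ^^ n) y \<in> S"
    by (rule *; simp add: bij_funpow_inv[OF assms])+
qed

lemma mem_plus_part: "bij \<alpha> \<Longrightarrow> x \<in> plus_part \<alpha> U \<longleftrightarrow> (\<forall>n. (inv \<alpha> ^^ n) x \<in> U)"
  by (simp add: plus_part_def mem_funpow_image)

lemma mem_minus_part: "bij \<alpha> \<Longrightarrow> x \<in> minus_part \<alpha> U \<longleftrightarrow> (\<forall>n. (\<alpha> ^^ n) x \<in> U)"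
  by (simp add: minus_part_def mem_funpow_image)

lemma minus_part_inv: "bij \<alpha> \<Longrightarrow> minus_part (inv \<alpha>) U = plus_part \<alpha> U"
  by (simp add: minus_part_def plus_part_def inv_inv_eq)

lemma Aut_id: "id \<in> Aut"
  by (auto simp: Aut_def)

lemma Aut_comp: "\<alpha> \<in> Aut \<Longrightarrow> \<beta> \<in> Aut \<Longrightarrow> \<alpha> \<circ> \<beta> \<in> Aut"
  by (auto simp: Aut_def bij_comp o_inv_distrib intro: continuous_on_compose2[of UNIV])

lemma Aut_funpow: "\<alpha> \<in> Aut \<Longrightarrow> \<alpha> ^^ n \<in> Aut"
  by (induction n) (auto intro: Aut_comp simp: Aut_id simp flip: id_def)

lemma is_subgroup_INT: "(\<And>i. i \<in> I \<Longrightarrow> is_subgroup (S i)) \<Longrightarrow> is_subgroup (\<Inter>i\<in>I. S i)"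
  by (simp add: is_subgroup_def)

lemma plus_part_subgroup: "\<alpha> \<in> Aut \<Longrightarrow> is_subgroup U \<Longrightarrow> is_subgroup (plus_part \<alpha> U)"
  unfolding plus_part_def by (intro is_subgroup_INT Aut_subgroup Aut_funpow)

lemma plus_part_closed:
  fixes U :: "'a::{topological_group_add,t2_space} set"
  assumes "\<alpha> \<in> Aut" "compact U"
  shows "closed (plus_part \<alpha> U)"
  unfolding plus_part_def
  using compact_continuous_image[OF AutD(3)[OF Aut_funpow[OF assms(1)]] assms(2)]
  by (intro closed_INT ballI compact_imp_closed)

text \<open>By Baire's theorem in the compact space \<open>Y \<inter> U\<close>, where \<open>Y\<close> is the union, some \<open>Q n\<close> contains a
  nonempty open subset of \<open>Y\<close>. It is then open in \<open>Y\<close>, so \<open>K\<close> is covered by finitely many translates of a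
  neighbourhood that \<open>Y\<close> meets inside \<open>Q n\<close>.\<close>

lemma compact_subset_increasing_union:
  fixes Q :: "nat \<Rightarrow> 'a::{topological_group_add,t2_space} set" and U :: "'a set"
  assumes U: "compact U" "open U" "0 \<in> U"
    and Q: "\<And>n. is_subgroup (Q n)" "\<And>n. closed (Q n)" "\<And>m n. m \<le> n \<Longrightarrow> Q m \<subseteq> Q n"
    and closed: "closed (\<Union>n. Q n)"
    and K: "compact K" "K \<subseteq> (\<Union>n. Q n)"
  shows "\<exists>L. K \<subseteq> Q L"
proof -
  define Y where "Y = (\<Union>n. Q n)"
  define X where "X = top_of_set (Y \<inter> U)"
  have Ysub: "x + y \<in> Y" if xy: "x \<in> Y" "y \<in> Y" for x y
  proof -
    obtain m n where "x \<in> Q m" "y \<in> Q n" using xy Y_def by blast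
    then have "x \<in> Q (max m n)" "y \<in> Q (max m n)" using Q(3)[of m "max m n"] Q(3)[of n "max m n"] by auto
    then have "x + y \<in> Q (max m n)" by (rule is_subgroupD(2)[OF Q(1)])
    then show ?thesis unfolding Y_def by blast
  qed
  have "compact (Y \<inter> U)" using closed U(1) by (simp add: Y_def closed_Int_compact)
  then have cs: "compact_space X" by (simp add: X_def compact_space_subtopology compactin_euclidean_iff)
  have haus: "Hausdorff_space X"
    unfolding X_def by (rule Hausdorff_space_subtopology) (use hausdorff in \<open>fastforce simp: Hausdorff_space_def disjnt_def\<close>)
  have lc: "locally_compact_space X \<and> regular_space X"
    using cs haus compact_imp_locally_compact_space compact_Hausdorff_imp_regular_space by blast
  have "\<exists>n. X interior_of (Q n \<inter> U) \<noteq> {}"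
  proof (rule ccontr)
    assume "\<not> ?thesis"
    then have *: "X interior_of (Q n \<inter> U) = {}" for n by blast
    have "X interior_of \<Union>(range (\<lambda>n. Q n \<inter> U)) = {}"
    proof (rule Baire_category_alt)
      show "completely_metrizable_space X \<or> locally_compact_space X \<and> regular_space X" using lc by blast
      fix T assume "T \<in> range (\<lambda>n. Q n \<inter> U)"
      then obtain n where n: "T = Q n \<inter> U" by blast
      have "T = (Y \<inter> U) \<inter> Q n" using n Y_def by blast
      then have "closedin X T" using Q(2) unfolding X_def by (simp add: closedin_closed_Int)
      then show "closedin X T \<and> X interior_of T = {}" using * n by simp
    qed simp
    moreover have "\<Union>(range (\<lambda>n. Q n \<inter> U)) = topspace X" by (auto simp: X_def Y_def)
    ultimately have "topspace X = {}" by simp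
    moreover have "0 \<in> topspace X" using is_subgroupD(1)[OF Q(1)[of 0]] U(3) by (auto simp: X_def Y_def)
    ultimately show False by blast
  qed
  then obtain n x0 where n: "x0 \<in> X interior_of (Q n \<inter> U)" by blast
  then obtain T0 where T0: "openin X T0" "x0 \<in> T0" "T0 \<subseteq> Q n \<inter> U" unfolding interior_of_def by auto
  then obtain T where T: "open T" "T0 = (Y \<inter> U) \<inter> T" unfolding X_def openin_open by metis
  \<comment> \<open>Translating the interior point \<open>x0\<close> to \<open>0\<close> gives a neighbourhood of \<open>0\<close> that \<open>Y\<close> meets inside \<open>Q n\<close>.\<close>
  define N where "N = (+) (- x0) ` (T \<inter> U)"
  have N: "open N" "0 \<in> N"
    using open_translate[of "T \<inter> U"] T U(2) T0(2) by (auto simp: N_def mem_translate)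
  have NQ: "y \<in> Q n" if y: "y \<in> N" "y \<in> Y" for y
  proof -
    have x0: "x0 \<in> Q n" "x0 \<in> Y" using T0 T by auto
    have "x0 + y \<in> T \<inter> U" using y(1) by (simp add: N_def mem_translate)
    then have "x0 + y \<in> T0" using Ysub[OF x0(2) y(2)] T(2) by blast
    then have "- x0 + (x0 + y) \<in> Q n"
      using T0(3) is_subgroupD(2)[OF Q(1) is_subgroupD(3)[OF Q(1) x0(1)]] by blast
    then show ?thesis by simp
  qed
  have "\<forall>x\<in>K. \<exists>l. x \<in> Q l" using K(2) by blast
  then obtain l where l: "\<And>x. x \<in> K \<Longrightarrow> x \<in> Q (l x)" by metis
  have "K \<subseteq> (\<Union>x\<in>K. (+) x ` N)" using N(2) by (force simp: mem_translate)
  then obtain D where D: "D \<subseteq> K" "finite D" "K \<subseteq> (\<Union>x\<in>D. (+) x ` N)"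
    using compactE_image[OF K(1), of K "\<lambda>x. (+) x ` N"] open_translate[OF N(1)] by blast
  obtain L where L: "\<And>x. x \<in> D \<Longrightarrow> l x < L" using D(2) by (metis finite_imageI finite_nat_set_iff_bounded imageI)
  have "K \<subseteq> Q (max L n)"
  proof
    fix y assume y: "y \<in> K"
    then obtain x where x: "x \<in> D" "- x + y \<in> N" using D(3) by (auto simp: mem_translate)
    have xl: "x \<in> Q (l x)" using l D(1) x(1) by blast
    have "l x \<le> max L n" using L[OF x(1)] by simp
    then have xL: "x \<in> Q (max L n)" using Q(3) xl by blast
    have "- x \<in> Y" using is_subgroupD(3)[OF Q(1) xl] unfolding Y_def by blast
    moreover have "y \<in> Y" using y K(2) unfolding Y_def by blast
    ultimately have "- x + y \<in> Q n" using NQ[OF x(2)] Ysub by blast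
    then have "- x + y \<in> Q (max L n)" using Q(3)[of n "max L n"] by auto
    then have "x + (- x + y) \<in> Q (max L n)" using xL is_subgroupD(2)[OF Q(1)] by blast
    then show "y \<in> Q (max L n)" by simp
  qed
  then show ?thesis by blast
qed

text \<open>Write \<open>x = u + v\<close> with \<open>u \<in> plus_part \<alpha> U\<close> and \<open>v \<in> minus_part \<alpha> U\<close>; the orbit of \<open>v\<close> stays in
  \<open>U\<close>, so it remains to control that of \<open>u\<close>. It lies in a compact
  subset of the union of the groups \<open>Q n = (\<alpha> ^^ n) ` plus_part \<alpha> U\<close>. This union is closed by tidiness for
  \<open>inv \<alpha>\<close>, so the orbit lies in a single \<open>Q L\<close>, and shifting by \<open>L\<close> brings it back into \<open>U\<close>.\<close>

lemma tidy_bounded_orbit: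
  fixes U :: "'a::{topological_group_add,t2_space} set"
  assumes \<alpha>: "\<alpha> \<in> Aut" and tidy: "tidy \<alpha> U" "tidy (inv \<alpha>) U"
    and x: "x \<in> U" and K: "compact K" "\<And>n. (\<alpha> ^^ n) x \<in> K"
  shows "x \<in> minus_part \<alpha> U"
proof -
  have b: "bij \<alpha>" by (rule AutD(1)[OF \<alpha>])
  have U: "is_subgroup U" "compact U" "open U" using tidy(1) by (auto simp: tidy_def compact_open_subgroup_def)
  define P where "P = plus_part \<alpha> U"
  define Q where "Q n = (\<alpha> ^^ n) ` P" for n
  have hom: "(\<alpha> ^^ n) (u + v) = (\<alpha> ^^ n) u + (\<alpha> ^^ n) v" for n u v
    by (rule AutD(2)[OF Aut_funpow[OF \<alpha>]])
  have memQ: "y \<in> Q n \<longleftrightarrow> (\<forall>m\<ge>n. (inv \<alpha> ^^ m) y \<in> U)" for y n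
  proof -
    have "y \<in> Q n \<longleftrightarrow> (\<forall>m. (inv \<alpha> ^^ m) ((inv \<alpha> ^^ n) y) \<in> U)"
      unfolding Q_def P_def by (simp add: mem_funpow_image[OF b] mem_plus_part[OF b])
    also have "\<dots> \<longleftrightarrow> (\<forall>m. (inv \<alpha> ^^ (m + n)) y \<in> U)" by (simp add: funpow_add)
    also have "\<dots> \<longleftrightarrow> (\<forall>m\<ge>n. (inv \<alpha> ^^ m) y \<in> U)" by (metis le_add2 le_add_diff_inverse2)
    finally show ?thesis .
  qed
  have pow_compact: "compact ((\<alpha> ^^ n) ` S)" if "compact S" for n S
    using compact_continuous_image[OF AutD(3)[OF Aut_funpow[OF \<alpha>]] that] .
  have "is_subgroup P" unfolding P_def by (rule plus_part_subgroup[OF \<alpha> U(1)])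
  then have Qsub: "is_subgroup (Q n)" for n unfolding Q_def by (rule Aut_subgroup[OF Aut_funpow[OF \<alpha>]])
  have "closed P" unfolding P_def by (rule plus_part_closed[OF \<alpha> U(2)])
  moreover have PU: "P \<subseteq> U" using mem_plus_part[OF b, of _ U] by (metis P_def funpow_0 subsetI)
  ultimately have "compact P" using U(2) by (metis compact_Int_closed inf.absorb_iff2)
  then have Qcl: "closed (Q n)" for n unfolding Q_def by (intro compact_imp_closed pow_compact)
  have Qmono: "Q m \<subseteq> Q n" if "m \<le> n" for m n using that memQ by auto
  have "(\<Union>n. Q n) = (\<Union>n. (inv (inv \<alpha>) ^^ n) ` minus_part (inv \<alpha>) U)"
    unfolding Q_def P_def minus_part_inv[OF b] inv_inv_eq[OF b] ..
  then have Ycl: "closed (\<Union>n. Q n)" using tidy(2) unfolding tidy_def by simp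
  obtain u v where uv: "u \<in> P" "v \<in> minus_part \<alpha> U" "x = u + v"
    using tidy(1) x unfolding tidy_def P_def by blast
  have vU: "(\<alpha> ^^ n) v \<in> U" for n using uv(2) mem_minus_part[OF b] by blast
  \<comment> \<open>The orbit of \<open>u\<close> is the difference of that of \<open>x\<close>, which is in \<open>K\<close>, and that of \<open>v\<close>, which is in \<open>U\<close>.\<close>
  define K' where "K' = (\<lambda>p. fst p - snd p) ` (K \<times> U) \<inter> (\<Union>n. Q n)"
  have "compact K'" unfolding K'_def
    by (intro compact_Int_closed Ycl compact_continuous_image compact_Times K U continuous_intros)
  then obtain L where L: "K' \<subseteq> Q L"
    using compact_subset_increasing_union[OF U(2,3) is_subgroupD(1)[OF U(1)] Qsub Qcl Qmono Ycl, of K']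
    by (auto simp: K'_def)
  have uK: "(\<alpha> ^^ n) u \<in> K'" for n
  proof -
    have "(\<alpha> ^^ n) u = (\<alpha> ^^ n) x - (\<alpha> ^^ n) v" using hom[of n u v] uv(3) by simp
    moreover have "(\<alpha> ^^ n) u \<in> (\<Union>n. Q n)" using uv(1) Q_def by blast
    ultimately show ?thesis using K(2)[of n] vU[of n] by (force simp: K'_def)
  qed
  have "(\<alpha> ^^ n) u \<in> U" for n
  proof -
    have "(\<alpha> ^^ (L + n)) u \<in> Q L" using L uK by blast
    then have "(inv \<alpha> ^^ L) ((\<alpha> ^^ (L + n)) u) \<in> U" using memQ by blast
    then show ?thesis by (simp add: funpow_add bij_funpow_inv[OF b])
  qed
  then show ?thesis unfolding mem_minus_part[OF b] uv(3) hom using vU is_subgroupD(2)[OF U(1)] by blast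
qed

section \<open>Invariant chains in a flat group\<close>

locale flat_group =
  fixes \<H> :: "('a::{topological_group_add, t2_space} \<Rightarrow> 'a) set" and U :: "'a set"
  assumes td: "totally_disconnected (UNIV :: 'a set)"
    and \<H>: "subgroup_of_Aut \<H>"
    and U: "compact_open_subgroup U"
    and tidy: "tidy_for_group \<H> U"
begin

lemma \<H>_Aut: "\<alpha> \<in> \<H> \<Longrightarrow> \<alpha> \<in> Aut"
  and \<H>_id: "id \<in> \<H>"
  and \<H>_comp: "\<alpha> \<in> \<H> \<Longrightarrow> \<beta> \<in> \<H> \<Longrightarrow> \<alpha> \<circ> \<beta> \<in> \<H>"
  and \<H>_inv: "\<alpha> \<in> \<H> \<Longrightarrow> inv \<alpha> \<in> \<H>"
  using \<H> by (auto simp: subgroup_of_Aut_def)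

lemma \<H>_funpow: "\<alpha> \<in> \<H> \<Longrightarrow> \<alpha> ^^ n \<in> \<H>"
  by (induction n) (auto intro: \<H>_comp simp: \<H>_id simp flip: id_def)

lemma U_subgroup: "is_subgroup U" and U_compact: "compact U" and U_open: "open U"
  using U by (auto simp: compact_open_subgroup_def)

lemma bij: "\<alpha> \<in> \<H> \<Longrightarrow> bij \<alpha>"
  using \<H>_Aut AutD(1) by blast

lemma image_inv:
  assumes "\<alpha> \<in> \<H>"
  shows "inv \<alpha> ` (\<alpha> ` S) = S" "\<alpha> ` (inv \<alpha> ` S) = S"
  using bij[OF assms] by (simp_all add: image_inv_f_f bij_is_inj image_f_inv_f bij_is_surj)

lemma image_subset_iff_inv:
  assumes "\<alpha> \<in> \<H>"
  shows "\<alpha> ` S \<subseteq> T \<longleftrightarrow> S \<subseteq> inv \<alpha> ` T" "S \<subseteq> \<alpha> ` T \<longleftrightarrow> inv \<alpha> ` S \<subseteq> T"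
  using image_inv[OF assms] by (metis image_mono)+

lemma image_compact: "\<alpha> \<in> \<H> \<Longrightarrow> compact S \<Longrightarrow> compact (\<alpha> ` S)"
  by (rule compact_continuous_image[OF AutD(3)[OF \<H>_Aut]])

lemma funpow_stays:
  assumes "\<alpha> ` S \<subseteq> S" "x \<in> S"
  shows "(\<alpha> ^^ n) x \<in> S"
  using assms by (induction n) auto

lemma bounded_orbit_minus_part:
  assumes "\<alpha> \<in> \<H>" "x \<in> U" "compact K" "\<And>n. (\<alpha> ^^ n) x \<in> K"
  shows "x \<in> minus_part \<alpha> U"
  using assms tidy \<H>_Aut \<H>_inv by (intro tidy_bounded_orbit[of \<alpha>]) (auto simp: tidy_for_group_def)

lemma shrinking_minus_part:
  assumes "\<alpha> \<in> \<H>" "compact S" "\<alpha> ` S \<subseteq> S"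
  shows "S \<inter> U \<subseteq> minus_part \<alpha> U"
  using bounded_orbit_minus_part[OF assms(1) _ assms(2)] funpow_stays[OF assms(3)] by blast

lemma growing_plus_part:
  assumes "\<alpha> \<in> \<H>" "compact S" "S \<subseteq> \<alpha> ` S"
  shows "S \<inter> U \<subseteq> plus_part \<alpha> U"
  using shrinking_minus_part[OF \<H>_inv[OF assms(1)] assms(2)] assms(3)
  by (simp add: minus_part_inv[OF bij[OF assms(1)]] image_subset_iff_inv(2)[OF assms(1)])

text \<open>The name refers to the images of \<open>S\<close> under \<open>\<H>\<close>: since \<open>\<H>\<close> is a group, they are then linearly ordered by
  inclusion (\<open>chain_compare\<close>).\<close>

definition chain :: "'a set \<Rightarrow> bool" where
  "chain S \<longleftrightarrow> (\<forall>\<alpha>\<in>\<H>. \<alpha> ` S \<subseteq> S \<or> S \<subseteq> \<alpha> ` S)"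

lemma chain_image:
  assumes S: "chain S" and \<gamma>: "\<gamma> \<in> \<H>"
  shows "chain (\<gamma> ` S)"
  unfolding chain_def
proof
  fix \<alpha> assume \<alpha>: "\<alpha> \<in> \<H>"
  have "inv \<gamma> \<circ> (\<alpha> \<circ> \<gamma>) \<in> \<H>" using \<alpha> \<gamma> \<H>_comp \<H>_inv by blast
  then have "(inv \<gamma> \<circ> (\<alpha> \<circ> \<gamma>)) ` S \<subseteq> S \<or> S \<subseteq> (inv \<gamma> \<circ> (\<alpha> \<circ> \<gamma>)) ` S" using S unfolding chain_def by blast
  then have "inv \<gamma> ` (\<alpha> ` (\<gamma> ` S)) \<subseteq> S \<or> S \<subseteq> inv \<gamma> ` (\<alpha> ` (\<gamma> ` S))" by (simp only: image_comp o_assoc)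
  then show "\<alpha> ` \<gamma> ` S \<subseteq> \<gamma> ` S \<or> \<gamma> ` S \<subseteq> \<alpha> ` \<gamma> ` S"
    unfolding image_subset_iff_inv(2)[OF \<gamma>, of "\<alpha> ` \<gamma> ` S"] image_subset_iff_inv(1)[OF \<gamma>, of S] .
qed

lemma chain_compare:
  assumes S: "chain S" and \<alpha>: "\<alpha> \<in> \<H>" and \<beta>: "\<beta> \<in> \<H>"
  shows "\<alpha> ` S \<subseteq> \<beta> ` S \<or> \<beta> ` S \<subseteq> \<alpha> ` S"
proof -
  have "inv \<beta> \<circ> \<alpha> \<in> \<H>" using \<alpha> \<beta> \<H>_comp \<H>_inv by blast
  then have "inv \<beta> ` (\<alpha> ` S) \<subseteq> S \<or> S \<subseteq> inv \<beta> ` (\<alpha> ` S)"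
    using S unfolding chain_def image_comp by blast
  then show ?thesis
    unfolding image_subset_iff_inv(2)[OF \<beta>, of "\<alpha> ` S"] image_subset_iff_inv(1)[OF \<beta>, of S] .
qed

end

locale invariant_subgroup = flat_group +
  fixes H :: "'a set"
  assumes H: "is_subgroup H" "closed H" and H_inv: "\<And>\<alpha>. \<alpha> \<in> \<H> \<Longrightarrow> \<alpha> ` H = H"

sublocale invariant_subgroup \<subseteq> tdlc_group H "U \<inter> H"
  by (rule tdlc_group_closed_subgroup[OF td U H])

context invariant_subgroup begin

lemma homeo: "\<alpha> \<in> \<H> \<Longrightarrow> homeo_onto H \<alpha>"
  using \<H>_Aut H_inv by (auto simp: homeo_onto_def Aut_def)

lemma modular_pos: "\<alpha> \<in> \<H> \<Longrightarrow> 0 < modular H \<alpha>"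
  using modular_eq(2) \<H>_Aut H_inv by blast

lemma modular_comp:
  assumes \<alpha>: "\<alpha> \<in> \<H>" and \<beta>: "\<beta> \<in> \<H>"
  shows "modular H (\<alpha> \<circ> \<beta>) = modular H \<alpha> * modular H \<beta>"
proof -
  obtain \<mu> where \<mu>: "left_Haar_measure H \<mu>" using ex_Haar by blast
  define W where "W = U \<inter> H"
  have W: "W \<in> compact_opens H" "W \<noteq> {}" using E is_subgroupD(1)[OF E(1)] by (auto simp: W_def)
  have s: "C \<in> sets \<mu>" if "C \<in> compact_opens H" for C
    using compact_opens_sets[OF that] left_HaarD(1)[OF \<mu>] by simp
  have m: "emeasure \<mu> (\<gamma> ` C) = ennreal (modular H \<gamma>) * emeasure \<mu> C" if "\<gamma> \<in> \<H>" "C \<in> compact_opens H" for \<gamma> C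
    using modular_eq(3)[OF \<H>_Aut[OF that(1)] H_inv[OF that(1)] \<mu> s[OF that(2)]] .
  have "ennreal (modular H (\<alpha> \<circ> \<beta>)) * emeasure \<mu> W = emeasure \<mu> (\<alpha> ` (\<beta> ` W))"
    using m[OF \<H>_comp[OF \<alpha> \<beta>] W(1)] by (simp add: image_comp)
  also have "\<dots> = ennreal (modular H \<alpha>) * (ennreal (modular H \<beta>) * emeasure \<mu> W)"
    using m[OF \<alpha> homeo_onto_compact_opens[OF homeo[OF \<beta>] W(1)]] m[OF \<beta> W(1)] by simp
  also have "\<dots> = ennreal (modular H \<alpha> * modular H \<beta>) * emeasure \<mu> W"
    using modular_pos[OF \<alpha>] modular_pos[OF \<beta>] by (simp add: ennreal_mult mult.assoc)
  finally have "ennreal (modular H (\<alpha> \<circ> \<beta>)) * emeasure \<mu> W = ennreal (modular H \<alpha> * modular H \<beta>) * emeasure \<mu> W" .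
  moreover have "emeasure \<mu> W > 0" "emeasure \<mu> W < \<infinity>" using Haar_compact_open_pos_finite[OF \<mu> W(1)] W(2) by auto
  ultimately have "ennreal (modular H (\<alpha> \<circ> \<beta>)) = ennreal (modular H \<alpha> * modular H \<beta>)"
    by (metis ennreal_mult_cancel_left mult.commute less_irrefl infinity_ennreal_def)
  then show ?thesis
    using modular_pos[OF \<alpha>] modular_pos[OF \<beta>] modular_pos[OF \<H>_comp[OF \<alpha> \<beta>]] by (simp add: ennreal_inj)
qed

lemma modular_gt_one:
  assumes \<alpha>: "\<alpha> \<in> \<H>" and C: "C \<in> compact_opens H" "C \<noteq> {}" and sub: "C \<subset> \<alpha> ` C"
  shows "modular H \<alpha> > 1"
proof -
  obtain \<mu> where \<mu>: "left_Haar_measure H \<mu>" using ex_Haar by blast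
  have s: "C \<in> sets \<mu>" if "C \<in> compact_opens H" for C
    using compact_opens_sets[OF that] left_HaarD(1)[OF \<mu>] by simp
  have aC: "\<alpha> ` C \<in> compact_opens H" by (rule homeo_onto_compact_opens[OF homeo[OF \<alpha>] C(1)])
  define D where "D = \<alpha> ` C - C"
  have D: "D \<in> compact_opens H" "D \<noteq> {}" using compact_opens_ring(4)[OF aC C(1)] sub by (auto simp: D_def)
  have "emeasure \<mu> (C \<union> D) = emeasure \<mu> C + emeasure \<mu> D"
    by (rule plus_emeasure[symmetric]) (use s[OF C(1)] s[OF D(1)] in \<open>auto simp: D_def\<close>)
  moreover have "C \<union> D = \<alpha> ` C" using sub by (auto simp: D_def)
  ultimately have *: "ennreal (modular H \<alpha>) * emeasure \<mu> C = emeasure \<mu> C + emeasure \<mu> D"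
    using modular_eq(3)[OF \<H>_Aut[OF \<alpha>] H_inv[OF \<alpha>] \<mu> s[OF C(1)]] by simp
  have fin: "emeasure \<mu> C < \<infinity>" "emeasure \<mu> D > 0"
    using Haar_compact_open_pos_finite[OF \<mu> C(1)] Haar_compact_open_pos_finite[OF \<mu> D(1)] D(2) by auto
  show ?thesis
  proof (rule ccontr)
    assume "\<not> ?thesis"
    then have "ennreal (modular H \<alpha>) \<le> 1" by simp
    then have "ennreal (modular H \<alpha>) * emeasure \<mu> C \<le> 1 * emeasure \<mu> C" by (rule mult_right_mono) simp
    then have "emeasure \<mu> C + emeasure \<mu> D \<le> emeasure \<mu> C + 0" using * by simp
    then show False using fin by (auto simp: ennreal_add_left_cancel_le)
  qed
qed

lemma modular_eq_one:
  assumes \<alpha>: "\<alpha> \<in> \<H>" and C: "C \<in> compact_opens H" "C \<noteq> {}" and eq: "\<alpha> ` C = C"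
  shows "modular H \<alpha> = 1"
proof -
  obtain \<mu> where \<mu>: "left_Haar_measure H \<mu>" using ex_Haar by blast
  have s: "C \<in> sets \<mu>" using compact_opens_sets[OF C(1)] left_HaarD(1)[OF \<mu>] by simp
  have "ennreal (modular H \<alpha>) * emeasure \<mu> C = 1 * emeasure \<mu> C"
    using modular_eq(3)[OF \<H>_Aut[OF \<alpha>] H_inv[OF \<alpha>] \<mu> s] eq by simp
  moreover have "emeasure \<mu> C > 0" "emeasure \<mu> C < \<infinity>" using Haar_compact_open_pos_finite[OF \<mu> C(1)] C(2) by auto
  ultimately have "ennreal (modular H \<alpha>) = 1"
    by (metis ennreal_mult_cancel_left mult.commute less_irrefl infinity_ennreal_def)
  then show ?thesis using modular_pos[OF \<alpha>] by (simp add: ennreal_eq_1)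
qed

end

section \<open>Scaling subgroups and the signs of a root\<close>

locale rooted = flat_group +
  fixes \<rho> :: "('a \<Rightarrow> 'a) \<Rightarrow> int" and H0 :: "'a set"
  assumes root: "associated \<H> \<rho> H0"

sublocale rooted \<subseteq> S: invariant_subgroup \<H> U H0
  by unfold_locales (use root in \<open>auto simp: associated_def scaling_subgroup_def\<close>)

context rooted begin

lemma \<rho>_comp: "\<alpha> \<in> \<H> \<Longrightarrow> \<beta> \<in> \<H> \<Longrightarrow> \<rho> (\<alpha> \<circ> \<beta>) = \<rho> \<alpha> + \<rho> \<beta>"
  and \<rho>_surj: "\<rho> ` \<H> = UNIV"
  using root by (auto simp: associated_def surj_hom_to_int_def)

lemma \<rho>_id: "\<rho> id = 0"
  using \<rho>_comp[OF \<H>_id \<H>_id] by simp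

lemma \<rho>_inv: "\<alpha> \<in> \<H> \<Longrightarrow> \<rho> (inv \<alpha>) = - \<rho> \<alpha>"
  using \<rho>_comp[OF \<H>_inv[of \<alpha>], of \<alpha>] \<rho>_id bij[of \<alpha>] by (simp add: bij_is_inj)

lemma \<rho>_funpow: "\<alpha> \<in> \<H> \<Longrightarrow> \<rho> (\<alpha> ^^ n) = int n * \<rho> \<alpha>"
proof (induction n)
  case (Suc n)
  show ?case
    unfolding funpow.simps(2) \<rho>_comp[OF Suc.prems \<H>_funpow[OF Suc.prems]] Suc.IH[OF Suc.prems]
    by (simp add: algebra_simps)
qed (simp add: \<rho>_id flip: id_def)

lemma modular_H0:
  assumes "\<alpha> \<in> \<H>"
  shows "\<rho> \<alpha> \<le> 0 \<Longrightarrow> modular H0 \<alpha> \<le> 1" "\<rho> \<alpha> > 0 \<Longrightarrow> modular H0 \<alpha> > 1"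
proof -
  obtain s :: int where s: "s > 1" "\<And>\<alpha>. \<alpha> \<in> \<H> \<Longrightarrow> modular H0 \<alpha> = of_int s powi \<rho> \<alpha>"
    using root unfolding associated_def by blast
  have "modular H0 \<alpha> = real_of_int s powr real_of_int (\<rho> \<alpha>)"
    using s assms by (simp add: powr_real_of_int')
  then show "\<rho> \<alpha> \<le> 0 \<Longrightarrow> modular H0 \<alpha> \<le> 1" "\<rho> \<alpha> > 0 \<Longrightarrow> modular H0 \<alpha> > 1"
    using s(1) powr_mono[of "real_of_int (\<rho> \<alpha>)" 0 "real_of_int s"] powr_less_mono[of 0 "real_of_int (\<rho> \<alpha>)" "real_of_int s"]
    by auto
qed

text \<open>A point of \<open>H0\<close> lies in an image \<open>V'\<close> of the compact open subgroup \<open>V\<close> whose images cover \<open>H0\<close>. If \<open>\<rho> \<alpha> \<le> 0\<close>, then \<open>\<alpha>\<close> does not increase Haar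
  measure and so cannot enlarge \<open>V'\<close>; being comparable with \<open>V'\<close>, the image \<open>\<alpha> ` V'\<close> is contained in it.\<close>

lemma bounded_H0:
  assumes \<alpha>: "\<alpha> \<in> \<H>" "\<rho> \<alpha> \<le> 0" and x: "x \<in> H0"
  shows "\<exists>K. compact K \<and> (\<forall>n. (\<alpha> ^^ n) x \<in> K)"
proof -
  obtain V where V: "is_subgroup V" "compact V" "openin (top_of_set H0) V"
    "H0 = (\<Union>\<alpha>\<in>\<H>. \<alpha> ` V)" "\<forall>\<alpha>\<in>\<H>. V \<subseteq> \<alpha> ` V \<or> \<alpha> ` V \<subseteq> V"
    using root unfolding associated_def scaling_subgroup_def
    by (elim conjE exE) (rule that, assumption+)
  obtain \<gamma> where \<gamma>: "\<gamma> \<in> \<H>" "x \<in> \<gamma> ` V" using x V(4) by blast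
  define V' where "V' = \<gamma> ` V"
  have V': "V' \<in> compact_opens H0" "V' \<noteq> {}"
    using homeo_onto_compact_opens[OF S.homeo[OF \<gamma>(1)], of V] V(2,3) \<gamma>(2) by (auto simp: compact_opens_def V'_def)
  have "chain V" using V(5) by (auto simp: chain_def)
  then have "chain V'" unfolding V'_def by (rule chain_image[OF _ \<gamma>(1)])
  then have "\<alpha> ` V' \<subseteq> V' \<or> V' \<subseteq> \<alpha> ` V'" using \<alpha>(1) by (simp add: chain_def)
  moreover have "\<not> V' \<subset> \<alpha> ` V'"
    using S.modular_gt_one[OF \<alpha>(1) V'] modular_H0(1)[OF \<alpha>] by linarith
  ultimately have sub: "\<alpha> ` V' \<subseteq> V'" by blast
  show ?thesis using funpow_stays[OF sub] \<gamma>(2) compact_opensD(1)[OF V'(1)] by (auto simp: V'_def)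
qed

text \<open>The part of \<open>H0\<close> that tidiness controls: its points start in \<open>U\<close>. It replaces the subgroup \<open>V\<close> whose
  images cover \<open>H0\<close>, since \<open>V\<close> need not lie in \<open>U\<close>.\<close>

definition W :: "'a set" where "W = U \<inter> H0"

lemma W_minus_part: "\<alpha> \<in> \<H> \<Longrightarrow> \<rho> \<alpha> \<le> 0 \<Longrightarrow> W \<subseteq> minus_part \<alpha> U"
  unfolding W_def using bounded_H0 bounded_orbit_minus_part by (metis IntE subsetI)

lemma W_plus_part: "\<alpha> \<in> \<H> \<Longrightarrow> \<rho> \<alpha> \<ge> 0 \<Longrightarrow> W \<subseteq> plus_part \<alpha> U"
  using W_minus_part[OF \<H>_inv[of \<alpha>]] \<rho>_inv[of \<alpha>] minus_part_inv[OF bij[of \<alpha>]] by simp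

lemma W_shrinks:
  assumes \<alpha>: "\<alpha> \<in> \<H>" and sub: "W \<subseteq> minus_part \<alpha> U"
  shows "\<alpha> ` W \<subseteq> W"
proof
  fix y assume "y \<in> \<alpha> ` W"
  then obtain x where x: "x \<in> W" "y = \<alpha> x" by blast
  have "\<forall>n. (\<alpha> ^^ n) x \<in> U" using sub x(1) mem_minus_part[OF bij[OF \<alpha>]] by blast
  from this[rule_format, of 1] have "y \<in> U" using x(2) by simp
  moreover have "y \<in> H0" using S.H_inv[OF \<alpha>] x by (auto simp: W_def)
  ultimately show "y \<in> W" by (simp add: W_def)
qed

text \<open>If the forward orbits of \<open>W\<close> were bounded, \<open>\<alpha>\<close> would map \<open>W\<close> into itself; since \<open>inv \<alpha>\<close> does so
  too, \<open>\<alpha>\<close> would preserve \<open>W\<close> and hence its Haar measure, against \<open>\<rho> \<alpha> > 0\<close>.\<close>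

lemma W_unbounded:
  assumes \<alpha>: "\<alpha> \<in> \<H>" "\<rho> \<alpha> > 0" and K: "compact K" "W \<subseteq> K" "\<alpha> ` K \<subseteq> K"
  shows False
proof -
  have "W \<subseteq> minus_part \<alpha> U" using shrinking_minus_part[OF \<alpha>(1) K(1,3)] K(2) by (auto simp: W_def)
  then have "\<alpha> ` W \<subseteq> W" by (rule W_shrinks[OF \<alpha>(1)])
  moreover have "inv \<alpha> ` W \<subseteq> W"
    using W_shrinks[OF \<H>_inv[OF \<alpha>(1)] W_minus_part[OF \<H>_inv[OF \<alpha>(1)]]] \<rho>_inv[OF \<alpha>(1)] \<alpha>(2) by simp
  ultimately have eq: "\<alpha> ` W = W" using image_subset_iff_inv(2)[OF \<alpha>(1), of W W] by simp
  have "W \<noteq> {}" using is_subgroupD(1)[OF S.E(1)] by (auto simp: W_def)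
  then have "modular H0 \<alpha> = 1" using S.modular_eq_one[OF \<alpha>(1)] S.E(2) eq by (simp add: W_def)
  then show False using modular_H0(2)[OF \<alpha>] by simp
qed

text \<open>If \<open>\<rho> \<beta> = 0\<close> but \<open>f \<beta> > 0\<close>, then for large \<open>n\<close> the automorphism \<open>inv (\<beta> ^^ n) \<circ> \<sigma>\<close> has \<open>\<rho> = 1\<close> and \<open>f < 0\<close>.
  So \<open>f\<close> vanishes on the kernel of \<open>\<rho>\<close> and factors through \<open>\<rho>\<close>.\<close>

lemma hom_proportional:
  fixes f :: "('a \<Rightarrow> 'a) \<Rightarrow> real"
  assumes hom: "\<And>\<alpha> \<beta>. \<alpha> \<in> \<H> \<Longrightarrow> \<beta> \<in> \<H> \<Longrightarrow> f (\<alpha> \<circ> \<beta>) = f \<alpha> + f \<beta>"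
    and pos: "\<And>\<alpha>. \<alpha> \<in> \<H> \<Longrightarrow> \<rho> \<alpha> > 0 \<Longrightarrow> f \<alpha> > 0"
    and \<sigma>: "\<sigma> \<in> \<H>" "\<rho> \<sigma> = 1" and \<gamma>: "\<gamma> \<in> \<H>"
  shows "f \<gamma> = of_int (\<rho> \<gamma>) * f \<sigma>"
proof -
  have f_id: "f id = 0" using hom[OF \<H>_id \<H>_id] by simp
  have f_inv: "f (inv \<alpha>) = - f \<alpha>" if "\<alpha> \<in> \<H>" for \<alpha>
    using hom[OF \<H>_inv[OF that] that] f_id bij[OF that] by (simp add: bij_is_inj)
  have f_pow: "f (\<alpha> ^^ n) = real n * f \<alpha>" if "\<alpha> \<in> \<H>" for \<alpha> n
  proof (induction n)
    case (Suc n)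
    show ?case unfolding funpow.simps(2) hom[OF that \<H>_funpow[OF that]] Suc.IH by (simp add: algebra_simps)
  qed (simp add: f_id flip: id_def)
  have le: "f \<beta> \<le> 0" if \<beta>: "\<beta> \<in> \<H>" "\<rho> \<beta> = 0" for \<beta>
  proof (rule ccontr)
    assume "\<not> ?thesis"
    then obtain n where n: "f \<sigma> < real n * f \<beta>" using reals_Archimedean3[of "f \<beta>"] by auto
    define \<delta> where "\<delta> = inv (\<beta> ^^ n) \<circ> \<sigma>"
    have p: "\<beta> ^^ n \<in> \<H>" by (rule \<H>_funpow[OF \<beta>(1)])
    have "\<delta> \<in> \<H>" unfolding \<delta>_def by (rule \<H>_comp[OF \<H>_inv[OF p] \<sigma>(1)])
    moreover have "\<rho> \<delta> = 1"
      using \<rho>_comp[OF \<H>_inv[OF p] \<sigma>(1)] \<rho>_inv[OF p] \<rho>_funpow[OF \<beta>(1)] \<beta>(2) \<sigma>(2) by (simp add: \<delta>_def)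
    moreover have "f \<delta> = f \<sigma> - real n * f \<beta>"
      using hom[OF \<H>_inv[OF p] \<sigma>(1)] f_inv[OF p] f_pow[OF \<beta>(1)] by (simp add: \<delta>_def)
    ultimately show False using pos[of \<delta>] n by simp
  qed
  have zero: "f \<beta> = 0" if \<beta>: "\<beta> \<in> \<H>" "\<rho> \<beta> = 0" for \<beta>
    using le[OF \<beta>] le[OF \<H>_inv[OF \<beta>(1)]] \<rho>_inv[OF \<beta>(1)] f_inv[OF \<beta>(1)] \<beta>(2) by simp
  have nonneg: "f \<gamma> = of_int (\<rho> \<gamma>) * f \<sigma>" if \<gamma>: "\<gamma> \<in> \<H>" "\<rho> \<gamma> \<ge> 0" for \<gamma>
  proof -
    define n where "n = nat (\<rho> \<gamma>)"
    have n: "\<rho> \<gamma> = int n" using \<gamma>(2) by (simp add: n_def)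
    have p: "\<sigma> ^^ n \<in> \<H>" by (rule \<H>_funpow[OF \<sigma>(1)])
    have "\<rho> (inv (\<sigma> ^^ n) \<circ> \<gamma>) = 0"
      using \<rho>_comp[OF \<H>_inv[OF p] \<gamma>(1)] \<rho>_inv[OF p] \<rho>_funpow[OF \<sigma>(1)] \<sigma>(2) n by simp
    then have "f (inv (\<sigma> ^^ n) \<circ> \<gamma>) = 0" by (rule zero[OF \<H>_comp[OF \<H>_inv[OF p] \<gamma>(1)]])
    then show ?thesis using hom[OF \<H>_inv[OF p] \<gamma>(1)] f_inv[OF p] f_pow[OF \<sigma>(1)] n by simp
  qed
  show ?thesis
  proof (cases "\<rho> \<gamma> \<ge> 0")
    case False
    then show ?thesis using nonneg[OF \<H>_inv[OF \<gamma>]] \<rho>_inv[OF \<gamma>] f_inv[OF \<gamma>] by simp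
  qed (rule nonneg[OF \<gamma>])
qed

end

section \<open>The scaling subgroup spanned by a saturated subgroup\<close>

text \<open>The properties of a maximal sign part which make the union of its images a scaling subgroup. The
  condition \<open>saturated\<close> keeps the union from accumulating inside \<open>U\<close>.\<close>

locale saturated = rooted +
  fixes E :: "'a set"
  assumes E_sub: "is_subgroup E" and E_compact: "compact E" and E_U: "E \<subseteq> U"
    and E_chain: "chain E" and W_E: "W \<subseteq> E"
    and saturated: "\<And>\<gamma>. \<gamma> \<in> \<H> \<Longrightarrow> \<gamma> ` E \<inter> U \<subseteq> E"
begin

definition H1 :: "'a set" where "H1 = (\<Union>\<alpha>\<in>\<H>. \<alpha> ` E)"

lemma H1_Int_U: "U \<inter> H1 = E"
proof -
  have "id ` E \<subseteq> H1" unfolding H1_def using \<H>_id by blast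
  then have "E \<subseteq> H1" by simp
  then show ?thesis using saturated E_U by (auto simp: H1_def)
qed

lemma H1_subgroup: "is_subgroup H1"
  unfolding is_subgroup_def
proof (intro conjI ballI)
  have sub: "is_subgroup (\<alpha> ` E)" if "\<alpha> \<in> \<H>" for \<alpha> by (rule Aut_subgroup[OF \<H>_Aut[OF that] E_sub])
  show "0 \<in> H1" using is_subgroupD(1)[OF E_sub] H1_Int_U by blast
  fix x assume "x \<in> H1"
  then obtain \<alpha> where \<alpha>: "\<alpha> \<in> \<H>" "x \<in> \<alpha> ` E" by (auto simp: H1_def)
  show "- x \<in> H1" using is_subgroupD(3)[OF sub[OF \<alpha>(1)] \<alpha>(2)] \<alpha>(1) unfolding H1_def by blast
  fix y assume "y \<in> H1"
  then obtain \<beta> where \<beta>: "\<beta> \<in> \<H>" "y \<in> \<beta> ` E" by (auto simp: H1_def)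
  have "\<exists>\<gamma>\<in>\<H>. x \<in> \<gamma> ` E \<and> y \<in> \<gamma> ` E" using chain_compare[OF E_chain \<alpha>(1) \<beta>(1)] \<alpha> \<beta> by blast
  then obtain \<gamma> where \<gamma>: "\<gamma> \<in> \<H>" "x \<in> \<gamma> ` E" "y \<in> \<gamma> ` E" by blast
  then have "x + y \<in> \<gamma> ` E" by (intro is_subgroupD(2)[OF sub[OF \<gamma>(1)]])
  then show "x + y \<in> H1" using \<gamma>(1) unfolding H1_def by blast
qed

text \<open>A subgroup that meets a neighbourhood of the identity in a closed set is closed: a point \<open>x\<close> of the closure can be
  translated by some \<open>h \<in> H1\<close> close to \<open>x\<close> into \<open>closure E = E\<close>.\<close>

lemma H1_closed: "closed H1"
proof -
  have "x \<in> H1" if x: "x \<in> closure H1" for x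
  proof -
    have "open ((+) x ` U)" "x \<in> (+) x ` U"
      using open_translate[OF U_open] is_subgroupD(1)[OF U_subgroup] by (auto simp: mem_translate)
    then have "(+) x ` U \<inter> H1 \<noteq> {}" using x open_Int_closure_eq_empty[of "(+) x ` U" H1] by blast
    then obtain h where h: "h \<in> H1" "h \<in> (+) x ` U" by blast
    have "- (- x + h) \<in> U" using is_subgroupD(3)[OF U_subgroup] h(2) by (simp add: mem_translate)
    then have "x \<in> (+) h ` U" by (simp add: mem_translate minus_add)
    then have "x \<in> closure ((+) h ` U \<inter> H1)"
      using x open_Int_closure_subset[OF open_translate[OF U_open]] by blast
    also have "(+) h ` U \<inter> H1 = (+) h ` E"
      using translate_Int[OF H1_subgroup h(1), of U] H1_Int_U by (simp add: Int_commute)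
    finally have "x \<in> (+) h ` E"
      using compact_imp_closed[OF compact_translate[OF E_compact]] by (simp add: closure_closed)
    then show ?thesis using is_subgroupD(2)[OF H1_subgroup h(1)] H1_Int_U by blast
  qed
  then have "closure H1 \<subseteq> H1" by blast
  then show ?thesis using closure_subset_eq by blast
qed

lemma H1_invariant: "\<alpha> \<in> \<H> \<Longrightarrow> \<alpha> ` H1 = H1"
proof -
  have *: "\<alpha> ` H1 \<subseteq> H1" if "\<alpha> \<in> \<H>" for \<alpha>
  proof
    fix y assume "y \<in> \<alpha> ` H1"
    then obtain \<beta> where "\<beta> \<in> \<H>" "y \<in> \<alpha> ` (\<beta> ` E)" by (auto simp: H1_def)
    then show "y \<in> H1" using \<H>_comp[OF that] unfolding H1_def image_comp by blast
  qed
  assume \<alpha>: "\<alpha> \<in> \<H>"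
  show ?thesis using *[OF \<alpha>] *[OF \<H>_inv[OF \<alpha>]] image_subset_iff_inv(2)[OF \<alpha>, of H1 H1] by simp
qed

sublocale T: invariant_subgroup \<H> U H1
  by unfold_locales (use H1_subgroup H1_closed H1_invariant in auto)

lemma E_open: "E \<in> compact_opens H1"
  using T.E(2) H1_Int_U by simp

lemma E_grows:
  assumes \<gamma>: "\<gamma> \<in> \<H>" "\<rho> \<gamma> > 0"
  shows "E \<subset> \<gamma> ` E"
proof -
  have "\<not> \<gamma> ` E \<subseteq> E" using W_unbounded[OF \<gamma> E_compact W_E] by blast
  then show ?thesis using E_chain \<gamma>(1) by (auto simp: chain_def)
qed

text \<open>All automorphisms with \<open>\<rho> \<gamma> > 0\<close> strictly enlarge \<open>E\<close>, so \<open>hom_proportional\<close> applies to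
  \<open>\<lambda>\<alpha>. ln (modular H1 \<alpha>)\<close>.\<close>

theorem associated_H1: "associated \<H> \<rho> H1"
  unfolding associated_def
proof (intro conjI)
  show "surj_hom_to_int \<H> \<rho>" using root by (simp add: associated_def)
  obtain \<sigma> where \<sigma>: "\<sigma> \<in> \<H>" "\<rho> \<sigma> = 1" using \<rho>_surj by (metis UNIV_I imageE)
  have ne: "E \<noteq> {}" using is_subgroupD(1)[OF E_sub] by blast
  show "scaling_subgroup \<H> H1"
    unfolding scaling_subgroup_def
  proof (intro conjI)
    show "\<not> compact H1"
    proof
      assume "compact H1"
      then show False
        using W_unbounded[OF \<sigma>(1) _ \<open>compact H1\<close>] \<sigma>(2) H1_invariant[OF \<sigma>(1)] W_E H1_Int_U by auto
    qed
    show "\<forall>\<alpha>\<in>\<H>. \<alpha> ` H1 = H1" using H1_invariant by blast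
    show "\<exists>V. is_subgroup V \<and> compact V \<and> openin (top_of_set H1) V \<and>
          H1 = (\<Union>\<alpha>\<in>\<H>. \<alpha> ` V) \<and> (\<forall>\<alpha>\<in>\<H>. V \<subseteq> \<alpha> ` V \<or> \<alpha> ` V \<subseteq> V)"
    proof (intro exI[of _ E] conjI)
      show "\<forall>\<alpha>\<in>\<H>. E \<subseteq> \<alpha> ` E \<or> \<alpha> ` E \<subseteq> E" using E_chain unfolding chain_def by blast
    qed (use E_sub E_open in \<open>auto simp: compact_opens_def H1_def\<close>)
  qed (fact H1_subgroup, fact H1_closed)
  define t where "t = modular H1 \<sigma>"
  have t1: "t > 1" unfolding t_def
    by (rule T.modular_gt_one[OF \<sigma>(1) E_open ne E_grows[OF \<sigma>(1)]]) (use \<sigma>(2) in simp)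
  have E_grows_\<sigma>: "E \<subset> \<sigma> ` E" using E_grows[OF \<sigma>(1)] \<sigma>(2) by simp
  \<comment> \<open>The index of \<open>E\<close> in \<open>\<sigma> ` E\<close>, as a number of cosets; \<open>E\<close> appears as \<open>U \<inter> H1\<close>.\<close>
  have "t = T.content (\<sigma> ` E)"
    unfolding t_def using T.modular_eq(1)[OF \<H>_Aut[OF \<sigma>(1)] H1_invariant[OF \<sigma>(1)]] H1_Int_U by simp
  also have "\<dots> = real (T.num_cosets (U \<inter> H1) (\<sigma> ` E))"
  proof (rule T.content_eq_num_cosets)
    show "\<sigma> ` E \<in> compact_opens H1" by (rule homeo_onto_compact_opens[OF T.homeo[OF \<sigma>(1)] E_open])
    show "T.stable (U \<inter> H1) (\<sigma> ` E)"
      unfolding H1_Int_U by (rule T.stable_subgroup[OF Aut_subgroup[OF \<H>_Aut[OF \<sigma>(1)] E_sub]]) (use E_grows_\<sigma> in blast)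
  qed
  finally have t: "t = real_of_int (int (T.num_cosets (U \<inter> H1) (\<sigma> ` E)))" by simp
  show "\<exists>s::int. s > 1 \<and> (\<forall>\<alpha>\<in>\<H>. modular H1 \<alpha> = of_int s powi \<rho> \<alpha>)"
  proof (intro exI[of _ "int (T.num_cosets (U \<inter> H1) (\<sigma> ` E))"] conjI ballI)
    show "int (T.num_cosets (U \<inter> H1) (\<sigma> ` E)) > 1" using t t1 by simp
    fix \<gamma> assume \<gamma>: "\<gamma> \<in> \<H>"
    have "ln (modular H1 \<gamma>) = of_int (\<rho> \<gamma>) * ln (modular H1 \<sigma>)"
    proof (rule hom_proportional[of "\<lambda>\<alpha>. ln (modular H1 \<alpha>)", OF _ _ \<sigma> \<gamma>])
      show "ln (modular H1 (\<alpha> \<circ> \<beta>)) = ln (modular H1 \<alpha>) + ln (modular H1 \<beta>)" if "\<alpha> \<in> \<H>" "\<beta> \<in> \<H>" for \<alpha> \<beta>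
        using T.modular_comp[OF that] T.modular_pos[OF that(1)] T.modular_pos[OF that(2)] by (simp add: ln_mult)
      show "0 < ln (modular H1 \<alpha>)" if "\<alpha> \<in> \<H>" "\<rho> \<alpha> > 0" for \<alpha>
        using T.modular_gt_one[OF that(1) E_open ne E_grows[OF that]] by simp
    qed
    then have "modular H1 \<gamma> = exp (of_int (\<rho> \<gamma>) * ln t)"
      using T.modular_pos[OF \<gamma>] by (metis exp_ln t_def)
    also have "\<dots> = t powr of_int (\<rho> \<gamma>)" using t1 by (simp add: powr_def)
    also have "\<dots> = t powi \<rho> \<gamma>" using t1 by (simp add: powr_real_of_int')
    finally show "modular H1 \<gamma> = of_int (int (T.num_cosets (U \<inter> H1) (\<sigma> ` E))) powi \<rho> \<gamma>" using t by simp
  qed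
qed

end

section \<open>Maximal sign parts are eigenfactors\<close>

text \<open>Only the signs at the indices \<open>1, \<dots>, k\<close> matter.\<close>

lemma finite_sign_parts: "finite (range (\<lambda>\<epsilon>. sign_part \<alpha>s k \<epsilon> U))"
proof -
  have "sign_part \<alpha>s k \<epsilon> U = sign_part \<alpha>s k (\<lambda>i. i \<in> {i\<in>{1..k}. \<epsilon> i}) U" for \<epsilon>
    unfolding sign_part_def by (intro arg_cong2[of _ _ _ _ "(\<inter>)"] INF_cong) auto
  then have "range (\<lambda>\<epsilon>. sign_part \<alpha>s k \<epsilon> U) \<subseteq> (\<lambda>I. sign_part \<alpha>s k (\<lambda>i. i \<in> I) U) ` Pow {1..k}" by blast
  then show ?thesis by (rule finite_subset) simp
qed

context rooted begin

context
  fixes k :: nat and \<alpha>s :: "nat \<Rightarrow> 'a \<Rightarrow> 'a"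
  assumes \<alpha>s: "\<And>i. i \<in> {1..k} \<Longrightarrow> \<alpha>s i \<in> \<H>"
begin

lemma sign_part_subgroup: "is_subgroup (sign_part \<alpha>s k \<epsilon> U)"
proof -
  have "is_subgroup (if \<epsilon> i then plus_part (\<alpha>s i) U else minus_part (\<alpha>s i) U)" if "i \<in> {1..k}" for i
    using plus_part_subgroup[OF \<H>_Aut[OF \<alpha>s[OF that]] U_subgroup]
      plus_part_subgroup[OF \<H>_Aut[OF \<H>_inv[OF \<alpha>s[OF that]]] U_subgroup]
      minus_part_inv[OF bij[OF \<H>_inv[OF \<alpha>s[OF that]]]] bij[OF \<alpha>s[OF that]] by (simp add: inv_inv_eq)
  then have "is_subgroup (\<Inter>i\<in>{1..k}. if \<epsilon> i then plus_part (\<alpha>s i) U else minus_part (\<alpha>s i) U)"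
    by (rule is_subgroup_INT)
  then show ?thesis using U_subgroup unfolding sign_part_def is_subgroup_def by blast
qed

lemma sign_part_compact: "compact (sign_part \<alpha>s k \<epsilon> U)"
proof -
  have "closed (if \<epsilon> i then plus_part (\<alpha>s i) U else minus_part (\<alpha>s i) U)" if "i \<in> {1..k}" for i
    using plus_part_closed[OF \<H>_Aut[OF \<alpha>s[OF that]] U_compact]
      plus_part_closed[OF \<H>_Aut[OF \<H>_inv[OF \<alpha>s[OF that]]] U_compact]
      minus_part_inv[OF bij[OF \<H>_inv[OF \<alpha>s[OF that]]]] bij[OF \<alpha>s[OF that]] by (simp add: inv_inv_eq)
  then show ?thesis unfolding sign_part_def by (intro compact_Int_closed U_compact closed_INT) auto
qed

text \<open>Each \<open>\<alpha>s i\<close> moves the compact set \<open>S\<close> monotonically, so all orbits in \<open>S\<close> are bounded in one of the two time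
  directions, the same for all points of \<open>S\<close>; this direction is the sign at \<open>i\<close>.\<close>

lemma Int_U_sign_part:
  assumes S: "chain S" "compact S"
  shows "S \<inter> U \<subseteq> sign_part \<alpha>s k (\<lambda>i. S \<subseteq> \<alpha>s i ` S) U"
proof -
  have "S \<inter> U \<subseteq> (if S \<subseteq> \<alpha>s i ` S then plus_part (\<alpha>s i) U else minus_part (\<alpha>s i) U)" if i: "i \<in> {1..k}" for i
    using growing_plus_part[OF \<alpha>s[OF i] S(2)] shrinking_minus_part[OF \<alpha>s[OF i] S(2)] S(1) \<alpha>s[OF i]
    by (auto simp: chain_def)
  then show ?thesis unfolding sign_part_def by blast
qed

text \<open>A maximal sign part containing \<open>W\<close> is used. By \<open>Int_U_sign_part\<close> and maximality it absorbs \<open>\<gamma> ` E \<inter> U\<close> for every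
  \<open>\<gamma> \<in> \<H>\<close>. With \<open>\<gamma> = id\<close> its signs may be taken to be the directions in which the \<open>\<alpha>s i\<close>
  enlarge it, and then every factor \<open>(\<alpha>s i ^^ n) ` U\<close> or \<open>(inv (\<alpha>s i) ^^ n) ` U\<close> that defines it already occurs in the intersection
  that defines an eigenfactor.\<close>

lemma ex_saturated_eigenfactor:
  assumes chain: "\<And>\<epsilon>. chain (sign_part \<alpha>s k \<epsilon> U)"
  shows "\<exists>E. eigenfactor \<H> U E \<and> saturated \<H> U \<rho> H0 E"
proof -
  define \<S> where "\<S> = {S \<in> range (\<lambda>\<epsilon>. sign_part \<alpha>s k \<epsilon> U). W \<subseteq> S}"
  have "W \<subseteq> sign_part \<alpha>s k (\<lambda>i. \<rho> (\<alpha>s i) \<ge> 0) U"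
  proof -
    have "W \<subseteq> (if \<rho> (\<alpha>s i) \<ge> 0 then plus_part (\<alpha>s i) U else minus_part (\<alpha>s i) U)" if i: "i \<in> {1..k}" for i
      using W_plus_part[OF \<alpha>s[OF i]] W_minus_part[OF \<alpha>s[OF i]] by auto
    then show ?thesis unfolding sign_part_def W_def by blast
  qed
  then have "\<S> \<noteq> {}" unfolding \<S>_def by blast
  moreover have "finite \<S>" unfolding \<S>_def using finite_sign_parts[of \<alpha>s k U] by simp
  ultimately obtain E where E: "E \<in> \<S>" "\<And>S. S \<in> \<S> \<Longrightarrow> E \<subseteq> S \<Longrightarrow> E = S"
    using finite_has_maximal[of \<S>] by metis
  obtain \<epsilon> where \<epsilon>: "E = sign_part \<alpha>s k \<epsilon> U" using E(1) by (auto simp: \<S>_def)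
  have WE: "W \<subseteq> E" using E(1) by (simp add: \<S>_def)
  have sub: "is_subgroup E" "compact E" "chain E" "E \<subseteq> U"
    using sign_part_subgroup sign_part_compact chain by (auto simp: \<epsilon> sign_part_def)
  have sat: "\<gamma> ` E \<inter> U \<subseteq> E \<and> (E \<subseteq> \<gamma> ` E \<longrightarrow> E = sign_part \<alpha>s k (\<lambda>i. \<gamma> ` E \<subseteq> \<alpha>s i ` (\<gamma> ` E)) U)" if \<gamma>: "\<gamma> \<in> \<H>" for \<gamma>
  proof (cases "E \<subseteq> \<gamma> ` E")
    case True
    let ?S = "sign_part \<alpha>s k (\<lambda>i. \<gamma> ` E \<subseteq> \<alpha>s i ` (\<gamma> ` E)) U"
    have "\<gamma> ` E \<inter> U \<subseteq> ?S" by (rule Int_U_sign_part[OF chain_image[OF sub(3) \<gamma>] image_compact[OF \<gamma> sub(2)]])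
    moreover from this have "E \<subseteq> ?S" using True sub(4) by blast
    moreover from this have "E = ?S" using E(2)[of ?S] WE unfolding \<S>_def by blast
    ultimately show ?thesis by simp
  next
    case False
    then show ?thesis using sub(3) \<gamma> unfolding chain_def by blast
  qed
  have Esp: "E = sign_part \<alpha>s k (\<lambda>i. E \<subseteq> \<alpha>s i ` E) U" using sat[OF \<H>_id] by simp
  have "E = (\<Inter>\<alpha>\<in>{\<alpha>\<in>\<H>. E \<subseteq> \<alpha> ` E}. \<alpha> ` U)"
  proof
    show "E \<subseteq> (\<Inter>\<alpha>\<in>{\<alpha>\<in>\<H>. E \<subseteq> \<alpha> ` E}. \<alpha> ` U)" using sub(4) by blast
    show "(\<Inter>\<alpha>\<in>{\<alpha>\<in>\<H>. E \<subseteq> \<alpha> ` E}. \<alpha> ` U) \<subseteq> E"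
    proof
      fix x assume x: "x \<in> (\<Inter>\<alpha>\<in>{\<alpha>\<in>\<H>. E \<subseteq> \<alpha> ` E}. \<alpha> ` U)"
      have xU: "x \<in> \<alpha> ` U" if "\<alpha> \<in> \<H>" "E \<subseteq> \<alpha> ` E" for \<alpha> using x that by blast
      have pow: "x \<in> (\<alpha> ^^ n) ` U" if \<alpha>: "\<alpha> \<in> \<H>" "E \<subseteq> \<alpha> ` E" for \<alpha> n
      proof (rule xU[OF \<H>_funpow[OF \<alpha>(1)]])
        show "E \<subseteq> (\<alpha> ^^ n) ` E"
        proof (induction n)
          case (Suc n)
          have "\<alpha> ` E \<subseteq> \<alpha> ` (\<alpha> ^^ n) ` E" using Suc by (rule image_mono)
          then show ?case using \<alpha>(2) by (simp add: image_comp)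
        qed simp
      qed
      have "x \<in> (if E \<subseteq> \<alpha>s i ` E then plus_part (\<alpha>s i) U else minus_part (\<alpha>s i) U)" if i: "i \<in> {1..k}" for i
      proof (cases "E \<subseteq> \<alpha>s i ` E")
        case True
        then show ?thesis using pow[OF \<alpha>s[OF i]] by (simp add: plus_part_def)
      next
        case False
        then have "\<alpha>s i ` E \<subseteq> E" using sub(3) \<alpha>s[OF i] unfolding chain_def by blast
        then have "E \<subseteq> inv (\<alpha>s i) ` E" using image_subset_iff_inv(1)[OF \<alpha>s[OF i], of E E] by simp
        then show ?thesis using False pow[OF \<H>_inv[OF \<alpha>s[OF i]]] by (simp add: minus_part_def)
      qed
      moreover have "x \<in> U" using xU[OF \<H>_id] by simp
      ultimately show "x \<in> E" by (subst Esp) (unfold sign_part_def, blast)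
    qed
  qed
  then have "eigenfactor \<H> U E" using sub unfolding eigenfactor_def chain_def by blast
  moreover have "saturated \<H> U \<rho> H0 E" by unfold_locales (use sub sat WE in auto)
  ultimately show ?thesis by blast
qed

end

end

theorem theorem3p10:
  fixes \<H> :: "('a::{topological_group_add, t2_space} \<Rightarrow> 'a) set"
    and U :: "'a set"
    and \<rho> :: "('a \<Rightarrow> 'a) \<Rightarrow> int"
    and k :: nat
    and \<alpha>s :: "nat \<Rightarrow> 'a \<Rightarrow> 'a"
  assumes "locally compact (UNIV :: 'a set)"
    and "totally_disconnected (UNIV :: 'a set)"
    and "subgroup_of_Aut \<H>"
    and "flat \<H>"
    and "compact_open_subgroup U"
    and "tidy_for_group \<H> U"
    and "\<rho> \<in> roots \<H>"
    and "\<And>i. i \<in> {1..k} \<Longrightarrow> \<alpha>s i \<in> \<H>"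
    and "\<And>(\<epsilon> :: nat \<Rightarrow> bool) \<alpha>. \<alpha> \<in> \<H> \<Longrightarrow>
           \<alpha> ` sign_part \<alpha>s k \<epsilon> U \<subseteq> sign_part \<alpha>s k \<epsilon> U \<or>
           sign_part \<alpha>s k \<epsilon> U \<subseteq> \<alpha> ` sign_part \<alpha>s k \<epsilon> U"
  shows "\<exists>E. eigenfactor \<H> U E \<and> associated \<H> \<rho> (\<Union>\<alpha>\<in>\<H>. \<alpha> ` E)"
proof -
  obtain H0 where H0: "associated \<H> \<rho> H0" using assms(7) by (auto simp: roots_def)
  interpret rooted \<H> U \<rho> H0
    by unfold_locales (fact assms(2), fact assms(3), fact assms(5), fact assms(6), fact H0)
  have chain: "chain (sign_part \<alpha>s k \<epsilon> U)" for \<epsilon> unfolding chain_def using assms(9) by blast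
  obtain E where E: "eigenfactor \<H> U E" "saturated \<H> U \<rho> H0 E"
    using ex_saturated_eigenfactor[of k \<alpha>s, OF assms(8) chain] by blast
  interpret saturated \<H> U \<rho> H0 E by (fact E(2))
  show ?thesis using E(1) associated_H1 unfolding H1_def by blast
qed

end
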